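(* Let $\Phi$ be an irreducible root system. Then $$E_\Phi(t)=\sum_{A'\subset P}t^{\mathrm{asc}(A')},$$ where the sum runs over all alcoves $A'$ contained in the fundamental parallelepiped $P$.
   Context: Let $V=\mathbb{R}^\ell$ with inner product $(\cdot,\cdot)$, $\Phi\subset V$ an irreducible crystallographic root system with Weyl group $W$, positive system $\Phi^+$, simple roots $\alpha_1,\dots,\alpha_\ell$. Highest root $\tilde\alpha=\sum_{i=1}^\ell c_i\alpha_i$ ($c_i\in\mathbb{Z}_{>0}$), $\alpha_0=-\tilde\alpha$, $c_0=1$. Coweight lattice $Z(\Phi)=\{x\mid(\alpha_i,x)\in\mathbb{Z}\ \forall i\}$ with basis $\varpi_1^\vee,\dots,\varpi_\ell^\vee$ dual to the simple roots; coroot lattice $\check Q(\Phi)=\sum_{\alpha\in\Phi}\mathbb{Z}\frac{2\alpha}{(\alpha,\alpha)}$; $f=\#Z(\Phi)/\check Q(\Phi)$. An alcove is a connected component of $V\setminus\bigcup_{\alpha\in\Phi^+,k\in\mathbb{Z}}\{x\mid(\alpha,x)=k\}$; the fundamental alcove is $A^\circ=\{x\mid(\alpha_i,x)>0\ (1\le i\le\ell),\ (\tilde\alpha,x)<1\}$. The fundamental parallelepiped is $P=\{x\in V\mid0<(\alpha_i,x)\le1,\ i=1,\dots,\ell\}$. For $w\in W$, $\mathrm{asc}(w)=\sum_{0\le i\le\ell,\ w(\alpha_i)\in\Phi^+}c_i$. Every alcove can be written as $A'=w(A^\circ)+\gamma$ with $w\in W$, $\gamma\in\check Q(\Phi)$,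 and $\mathrm{asc}(A'):=\mathrm{asc}(w)$ (this is independent of the choice). The generalized Eulerian polynomial is $E_\Phi(t)=\frac1f\sum_{w\in W}t^{\mathrm{asc}(w)}$. *)

theory Defs
  imports "HOL-Analysis.Analysis" "HOL-Computational_Algebra.Polynomial"
begin

definition coroot :: "'a::euclidean_space \<Rightarrow> 'a" where
  "coroot \<alpha> = (2 / (\<alpha> \<bullet> \<alpha>)) *\<^sub>R \<alpha>"

definition root_reflection :: "'a::euclidean_space \<Rightarrow> 'a \<Rightarrow> 'a" where
  "root_reflection \<alpha> x = x - (x \<bullet> coroot \<alpha>) *\<^sub>R \<alpha>"

definition root_system :: "'a::euclidean_space set \<Rightarrow> bool" where
  "root_system \<Phi> \<longleftrightarrow>
     finite \<Phi> \<and> 0 \<notin> \<Phi> \<and> span \<Phi> = UNIV \<and>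
     (\<forall>\<alpha>\<in>\<Phi>. root_reflection \<alpha> ` \<Phi> = \<Phi>) \<and>
     (\<forall>\<alpha>\<in>\<Phi>. \<forall>r::real. r *\<^sub>R \<alpha> \<in> \<Phi> \<longrightarrow> r = 1 \<or> r = -1)"

definition crystallographic :: "'a::euclidean_space set \<Rightarrow> bool" where
  "crystallographic \<Phi> \<longleftrightarrow> (\<forall>\<alpha>\<in>\<Phi>. \<forall>\<beta>\<in>\<Phi>. \<beta> \<bullet> coroot \<alpha> \<in> \<int>)"

definition irreducible_roots :: "'a::euclidean_space set \<Rightarrow> bool" where
  "irreducible_roots \<Phi> \<longleftrightarrow>
     \<Phi> \<noteq> {} \<and>
     \<not> (\<exists>A B. A \<noteq> {} \<and> B \<noteq> {} \<and> A \<inter> B = {} \<and> A \<union> B = \<Phi> \<and> (\<forall>a\<in>A. \<forall>b\<in>B. a \<bullet> b = 0))"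

text \<open>The group generated by the reflections; as these are involutions, closing
  under composition with them already yields inverses.\<close>

inductive_set weyl_group :: "'a::euclidean_space set \<Rightarrow> ('a \<Rightarrow> 'a) set"
  for \<Phi> :: "'a set" where
  weyl_id: "id \<in> weyl_group \<Phi>"
| weyl_step: "w \<in> weyl_group \<Phi> \<Longrightarrow> \<alpha> \<in> \<Phi> \<Longrightarrow> root_reflection \<alpha> \<circ> w \<in> weyl_group \<Phi>"

text \<open>Simple roots are a family \<open>\<alpha> 1, \<dots>, \<alpha> \<ell>\<close> with \<open>\<ell> = DIM('a)\<close>; all other
  values of \<open>\<alpha>\<close>, in particular \<open>\<alpha> 0\<close>, are irrelevant (for index 0 see
  \<open>extended_simple\<close> below).\<close>

definition nonneg_combs :: "(nat \<Rightarrow> 'a::euclidean_space) \<Rightarrow> 'a set" where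
  "nonneg_combs \<alpha> = {x. \<exists>n::nat \<Rightarrow> nat. x = (\<Sum>i=1..DIM('a). real (n i) *\<^sub>R \<alpha> i)}"

definition simple_system :: "'a::euclidean_space set \<Rightarrow> (nat \<Rightarrow> 'a) \<Rightarrow> bool" where
  "simple_system \<Phi> \<alpha> \<longleftrightarrow>
     inj_on \<alpha> {1..DIM('a)} \<and> independent (\<alpha> ` {1..DIM('a)}) \<and>
     \<alpha> ` {1..DIM('a)} \<subseteq> \<Phi> \<and>
     (\<forall>\<beta>\<in>\<Phi>. \<beta> \<in> nonneg_combs \<alpha> \<or> - \<beta> \<in> nonneg_combs \<alpha>)"

definition positive_roots :: "'a::euclidean_space set \<Rightarrow> (nat \<Rightarrow> 'a) \<Rightarrow> 'a set" where
  "positive_roots \<Phi> \<alpha> = \<Phi> \<inter> nonneg_combs \<alpha>"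

definition highest_root :: "'a::euclidean_space set \<Rightarrow> (nat \<Rightarrow> 'a) \<Rightarrow> 'a" where
  "highest_root \<Phi> \<alpha> = (THE \<theta>. \<theta> \<in> \<Phi> \<and> (\<forall>\<beta>\<in>\<Phi>. \<theta> - \<beta> \<in> nonneg_combs \<alpha>))"

definition extended_simple :: "'a::euclidean_space set \<Rightarrow> (nat \<Rightarrow> 'a) \<Rightarrow> nat \<Rightarrow> 'a" where
  "extended_simple \<Phi> \<alpha> i = (if i = 0 then - highest_root \<Phi> \<alpha> else \<alpha> i)"

text \<open>The numbers \<open>c\<^sub>i\<close>: the coordinates of the highest root in the basis of simple
  roots (positive integers, so nothing is lost in passing to \<open>nat\<close>), and \<open>c\<^sub>0 = 1\<close>.\<close>

definition mark :: "'a::euclidean_space set \<Rightarrow> (nat \<Rightarrow> 'a) \<Rightarrow> nat \<Rightarrow> nat" where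
  "mark \<Phi> \<alpha> i = (if i = 0 then 1
     else nat \<lfloor>representation (\<alpha> ` {1..DIM('a)}) (highest_root \<Phi> \<alpha>) (\<alpha> i)\<rfloor>)"

definition coweight_lattice :: "(nat \<Rightarrow> 'a::euclidean_space) \<Rightarrow> 'a set" where
  "coweight_lattice \<alpha> = {x. \<forall>i\<in>{1..DIM('a)}. \<alpha> i \<bullet> x \<in> \<int>}"

definition coroot_lattice :: "'a::euclidean_space set \<Rightarrow> 'a set" where
  "coroot_lattice \<Phi> = {x. \<exists>n::'a \<Rightarrow> int. x = (\<Sum>\<beta>\<in>\<Phi>. of_int (n \<beta>) *\<^sub>R coroot \<beta>)}"

definition connection_index :: "'a::euclidean_space set \<Rightarrow> (nat \<Rightarrow> 'a) \<Rightarrow> nat" where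
  "connection_index \<Phi> \<alpha> =
     card (coweight_lattice \<alpha> //
       {(x, y). x \<in> coweight_lattice \<alpha> \<and> y \<in> coweight_lattice \<alpha> \<and> x - y \<in> coroot_lattice \<Phi>})"

definition alcoves :: "'a::euclidean_space set \<Rightarrow> (nat \<Rightarrow> 'a) \<Rightarrow> 'a set set" where
  "alcoves \<Phi> \<alpha> =
     components (UNIV - (\<Union>\<beta>\<in>positive_roots \<Phi> \<alpha>. \<Union>k::int. {x. \<beta> \<bullet> x = of_int k}))"

definition fundamental_alcove :: "'a::euclidean_space set \<Rightarrow> (nat \<Rightarrow> 'a) \<Rightarrow> 'a set" where
  "fundamental_alcove \<Phi> \<alpha> =
     {x. (\<forall>i\<in>{1..DIM('a)}. 0 < \<alpha> i \<bullet> x) \<and> highest_root \<Phi> \<alpha> \<bullet> x < 1}"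

definition fundamental_parallelepiped :: "(nat \<Rightarrow> 'a::euclidean_space) \<Rightarrow> 'a set" where
  "fundamental_parallelepiped \<alpha> = {x. \<forall>i\<in>{1..DIM('a)}. 0 < \<alpha> i \<bullet> x \<and> \<alpha> i \<bullet> x \<le> 1}"

definition asc :: "'a::euclidean_space set \<Rightarrow> (nat \<Rightarrow> 'a) \<Rightarrow> ('a \<Rightarrow> 'a) \<Rightarrow> nat" where
  "asc \<Phi> \<alpha> w =
     (\<Sum>i\<in>{i\<in>{0..DIM('a)}. w (extended_simple \<Phi> \<alpha> i) \<in> positive_roots \<Phi> \<alpha>}. mark \<Phi> \<alpha> i)"

definition asc_alcove :: "'a::euclidean_space set \<Rightarrow> (nat \<Rightarrow> 'a) \<Rightarrow> 'a set \<Rightarrow> nat" where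
  "asc_alcove \<Phi> \<alpha> A =
     (THE n. \<exists>w\<in>weyl_group \<Phi>. \<exists>\<gamma>\<in>coroot_lattice \<Phi>.
        A = (\<lambda>x. w x + \<gamma>) ` fundamental_alcove \<Phi> \<alpha> \<and> n = asc \<Phi> \<alpha> w)"

definition generalized_eulerian :: "'a::euclidean_space set \<Rightarrow> (nat \<Rightarrow> 'a) \<Rightarrow> rat poly" where
  "generalized_eulerian \<Phi> \<alpha> =
     smult (1 / of_nat (connection_index \<Phi> \<alpha>)) (\<Sum>w\<in>weyl_group \<Phi>. monom 1 (asc \<Phi> \<alpha> w))"

end

(* Translating w(A0) by the coweight lattice Z brings it into the parallelepiped P in exactly one
   way, since P is a fundamental domain for Z; this gives a map from W to the alcoves in P. Its
   fibre over A' consists of those w for which A' is a Z-translate of w(A0). As the affine Weyl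
   group, the semidirect product of W with the coroot lattice Q, acts simply transitively on the
   alcoves, the fibre is in bijection with Z / Q and has f elements. On a fibre asc is constant:
   two of its elements differ by the linear part of a symmetry of A0, which permutes the extended
   simple roots and hence preserves the coefficients of their unique linear relation, the marks.
   Such a symmetry fixes the point where all wall functionals of A0 agree, because at that point
   they take the least value that any affine root positive on A0 takes there. *)

theory Submission
  imports Defs
begin

subsection \<open>Reflections\<close>

text \<open>Freeness of the action is arithmetic. If x |-> u x + \<mu> carries A0 into itself, then
  \<mu>, the image of 0, lies in the closure of A0, so no root exceeds 1 on it. Nonzero coweights
  with this property, the minuscule ones, are what Z contributes beyond Q: a nonzero element of Q is
  at least 2 on some root. Hence \<mu> = 0 once \<mu> is in Q; then u permutes the simple roots, and
  u = id by the exchange condition in W. Transitivity is metric, through the orbit point nearest to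
  a fixed point of A0.

  The special point is the sum of the fundamental coweights divided by the Coxeter number h. A root
  of height n has the value n / h there, so the affine roots positive on A0 are compared through
  heights alone: heights lie between 1 - h and h - 1, and the least value 1 / h occurs exactly for
  the simple roots and for 1 - \<theta>. That a symmetry carries walls to walls is then an equality
  case.\<close>

lemma linear_root_reflection: "linear (root_reflection a)"
  unfolding root_reflection_def
  by (intro linearI) (auto simp: inner_add_left algebra_simps)

lemma inner_coroot: "x \<bullet> coroot a = 2 * (x \<bullet> a) / (a \<bullet> a)"
  by (simp add: coroot_def)

lemma coroot_inner_self: "a \<noteq> 0 \<Longrightarrow> a \<bullet> coroot a = 2"
  by (simp add: inner_coroot)

lemma coroot_uminus: "coroot (- a) = - coroot a"
  by (simp add: coroot_def)

lemma root_reflection_uminus: "root_reflection (- a) = root_reflection a"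
  by (simp add: root_reflection_def coroot_uminus fun_eq_iff)

lemma root_reflection_swap: "root_reflection a x = x - (x \<bullet> a) *\<^sub>R coroot a"
  by (simp add: root_reflection_def inner_coroot coroot_def)

lemma root_reflection_inner: "root_reflection a x \<bullet> root_reflection a y = x \<bullet> y"
proof (cases "a = 0")
  case True
  then show ?thesis by (simp add: root_reflection_def)
next
  case False
  then have "a \<bullet> a \<noteq> 0" by simp
  then show ?thesis
    unfolding root_reflection_def inner_coroot
    by (simp add: inner_diff_left inner_diff_right field_simps inner_commute)
qed

lemma root_reflection_self: "a \<noteq> 0 \<Longrightarrow> root_reflection a a = - a"
  by (simp add: root_reflection_def coroot_inner_self scaleR_2)

lemma root_reflection_invol [simp]: "root_reflection a (root_reflection a x) = x"
proof (cases "a = 0")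
  case True
  then show ?thesis by (simp add: root_reflection_def)
next
  case False
  have "root_reflection a (root_reflection a x)
      = root_reflection a x - (x \<bullet> coroot a) *\<^sub>R root_reflection a a"
    by (subst (2) root_reflection_def)
      (simp add: linear_diff[OF linear_root_reflection] linear_cmul[OF linear_root_reflection])
  then show ?thesis
    using False by (simp add: root_reflection_self) (simp add: root_reflection_def)
qed

lemma orthogonal_root_reflection: "orthogonal_transformation (root_reflection a)"
  by (simp add: orthogonal_transformation_def linear_root_reflection root_reflection_inner)

lemma orthogonal_coroot:
  assumes "orthogonal_transformation w"
  shows "coroot (w a) = w (coroot a)"
  using assms by (simp add: coroot_def orthogonal_transformation_def linear_cmul)

lemma orthogonal_conjugate_reflection:
  assumes "orthogonal_transformation w"
  shows "root_reflection (w a) (w x) = w (root_reflection a x)"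
  using assms unfolding root_reflection_def orthogonal_coroot[OF assms]
  by (simp add: orthogonal_transformation_def linear_diff linear_cmul)

subsection \<open>Simple roots and heights\<close>

text \<open>The index set is a parameter because a constant of the locale whose type does not mention
  \<open>'a\<close> cannot be defined through \<open>DIM('a)\<close>.\<close>

locale root_basis =
  fixes \<Phi> :: "'a::euclidean_space set" and \<alpha> :: "nat \<Rightarrow> 'a" and I :: "nat set"
  assumes I_eq: "I = {1..DIM('a)}"
    and root_system: "root_system \<Phi>"
    and crystallographic: "crystallographic \<Phi>"
    and simple_system: "simple_system \<Phi> \<alpha>"
begin

abbreviation W :: "('a \<Rightarrow> 'a) set" where "W \<equiv> weyl_group \<Phi>"
abbreviation s :: "nat \<Rightarrow> 'a \<Rightarrow> 'a" where "s i \<equiv> root_reflection (\<alpha> i)"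
abbreviation Pos :: "'a set" where "Pos \<equiv> positive_roots \<Phi> \<alpha>"
abbreviation Z :: "'a set" where "Z \<equiv> coweight_lattice \<alpha>"
abbreviation Q :: "'a set" where "Q \<equiv> coroot_lattice \<Phi>"

lemma finite_I: "finite I"
  by (simp add: I_eq)

lemma finite_roots: "finite \<Phi>"
  and root_nonzero: "b \<in> \<Phi> \<Longrightarrow> b \<noteq> 0"
  and root_reflection_image: "b \<in> \<Phi> \<Longrightarrow> root_reflection b ` \<Phi> = \<Phi>"
  and root_multiple: "b \<in> \<Phi> \<Longrightarrow> r *\<^sub>R b \<in> \<Phi> \<Longrightarrow> r = 1 \<or> r = - 1"
  and span_roots: "span \<Phi> = UNIV"
  using root_system unfolding root_system_def by auto

lemma root_reflection_root: "a \<in> \<Phi> \<Longrightarrow> b \<in> \<Phi> \<Longrightarrow> root_reflection a b \<in> \<Phi>"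
  using root_reflection_image by blast

lemma root_uminus: "b \<in> \<Phi> \<Longrightarrow> - b \<in> \<Phi>"
  using root_reflection_root[of b b] by (simp add: root_reflection_self root_nonzero)

lemma cartan_integer: "a \<in> \<Phi> \<Longrightarrow> b \<in> \<Phi> \<Longrightarrow> b \<bullet> coroot a \<in> \<int>"
  using crystallographic unfolding crystallographic_def by auto

lemma simple_root: "i \<in> I \<Longrightarrow> \<alpha> i \<in> \<Phi>"
  and simple_inj: "inj_on \<alpha> I"
  and simple_independent: "independent (\<alpha> ` I)"
  and root_signed: "b \<in> \<Phi> \<Longrightarrow> b \<in> nonneg_combs \<alpha> \<or> - b \<in> nonneg_combs \<alpha>"
  using simple_system unfolding simple_system_def by (auto simp: I_eq)

lemma simple_span: "span (\<alpha> ` I) = UNIV"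
proof -
  have "card (\<alpha> ` I) = DIM('a)"
    using simple_inj by (simp add: card_image) (simp add: I_eq)
  then show ?thesis
    using card_ge_dim_independent[of "\<alpha> ` I" UNIV] simple_independent by (auto simp: dim_UNIV)
qed

lemma dual_point: "\<exists>x. \<forall>i\<in>I. \<alpha> i \<bullet> x = t i"
proof -
  obtain g :: "'a \<Rightarrow> real" where g: "linear g" "\<forall>x\<in>\<alpha> ` I. g x = t (inv_into I \<alpha> x)"
    using linear_independent_extend[OF simple_independent, of "\<lambda>x. t (inv_into I \<alpha> x)"] by blast
  \<comment> \<open>\<open>adjoint g 1\<close> is the vector that represents the functional
    \<open>g\<close> through the inner product.\<close>
  have "\<alpha> i \<bullet> adjoint g 1 = t i" if "i \<in> I" for i
  proof -
    have "\<alpha> i \<bullet> adjoint g 1 = g (\<alpha> i)"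
      using adjoint_works[OF g(1), of "\<alpha> i" 1] by simp
    also have "\<dots> = t i"
      using g(2) that inv_into_f_f[OF simple_inj that] by fastforce
    finally show ?thesis .
  qed
  then show ?thesis by blast
qed

text \<open>The fundamental coweights, i.e. the basis dual to the simple roots.\<close>

definition cw :: "nat \<Rightarrow> 'a" where
  "cw j = (SOME x. \<forall>i\<in>I. \<alpha> i \<bullet> x = (if i = j then 1 else 0))"

lemma simple_inner_cw: "i \<in> I \<Longrightarrow> \<alpha> i \<bullet> cw j = (if i = j then 1 else 0)"
  using someI_ex[OF dual_point[of "\<lambda>i. if i = j then 1 else 0"]] unfolding cw_def by auto

lemma sum_simple_inner_cw:
  assumes "j \<in> I"
  shows "(\<Sum>i\<in>I. c i *\<^sub>R \<alpha> i) \<bullet> cw j = c j"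
proof -
  have "(\<Sum>i\<in>I. c i *\<^sub>R \<alpha> i) \<bullet> cw j = (\<Sum>i\<in>I. if i = j then c j else 0)"
    by (auto simp: inner_sum_left simple_inner_cw intro!: sum.cong)
  then show ?thesis using assms finite_I by simp
qed

lemma simple_expansion: "x = (\<Sum>i\<in>I. (x \<bullet> cw i) *\<^sub>R \<alpha> i)"
proof -
  have "x \<in> span (\<alpha> ` I)" using simple_span by simp
  then obtain u where "x = (\<Sum>v\<in>\<alpha> ` I. u v *\<^sub>R v)"
    using span_finite[of "\<alpha> ` I"] finite_I by auto
  then have x: "x = (\<Sum>i\<in>I. u (\<alpha> i) *\<^sub>R \<alpha> i)"
    using simple_inj by (simp add: sum.reindex)
  then have "x \<bullet> cw i = u (\<alpha> i)" if "i \<in> I" for i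
    using sum_simple_inner_cw[OF that, of "\<lambda>i. u (\<alpha> i)"] by metis
  then have "(\<Sum>i\<in>I. (x \<bullet> cw i) *\<^sub>R \<alpha> i) = (\<Sum>i\<in>I. u (\<alpha> i) *\<^sub>R \<alpha> i)"
    by (intro sum.cong) auto
  then show ?thesis using x by metis
qed

lemma eq_by_coords:
  assumes "\<And>i. i \<in> I \<Longrightarrow> x \<bullet> cw i = y \<bullet> cw i"
  shows "x = y"
proof -
  have "(\<Sum>i\<in>I. (x \<bullet> cw i) *\<^sub>R \<alpha> i) = (\<Sum>i\<in>I. (y \<bullet> cw i) *\<^sub>R \<alpha> i)"
    using assms by (intro sum.cong) auto
  then show ?thesis
    using simple_expansion[of x] simple_expansion[of y] by (rule box_equals[OF _ sym sym])
qed

lemma inner_expansion: "x \<bullet> y = (\<Sum>i\<in>I. (x \<bullet> cw i) * (\<alpha> i \<bullet> y))"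
  using arg_cong[OF simple_expansion[of x], of "\<lambda>v. v \<bullet> y"] by (simp add: inner_sum_left)

lemma eq_by_simple:
  assumes "\<And>i. i \<in> I \<Longrightarrow> \<alpha> i \<bullet> x = \<alpha> i \<bullet> y"
  shows "x = y"
proof -
  have "z \<bullet> x = z \<bullet> y" for z
    unfolding inner_expansion[of z x] inner_expansion[of z y] by (intro sum.cong) (auto simp: assms)
  then show ?thesis using vector_eq_ldot by blast
qed

lemma nonneg_combs_iff: "x \<in> nonneg_combs \<alpha> \<longleftrightarrow> (\<forall>i\<in>I. x \<bullet> cw i \<in> \<nat>)"
proof
  assume "x \<in> nonneg_combs \<alpha>"
  then obtain n :: "nat \<Rightarrow> nat" where "x = (\<Sum>i\<in>I. real (n i) *\<^sub>R \<alpha> i)"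
    unfolding nonneg_combs_def I_eq by blast
  then show "\<forall>i\<in>I. x \<bullet> cw i \<in> \<nat>"
    by (simp add: sum_simple_inner_cw)
next
  assume "\<forall>i\<in>I. x \<bullet> cw i \<in> \<nat>"
  then have "\<forall>i\<in>I. \<exists>n. x \<bullet> cw i = real n"
    by (auto elim: Nats_cases)
  then obtain n :: "nat \<Rightarrow> nat" where "\<And>i. i \<in> I \<Longrightarrow> x \<bullet> cw i = real (n i)"
    by metis
  then have "(\<Sum>i\<in>I. (x \<bullet> cw i) *\<^sub>R \<alpha> i) = (\<Sum>i\<in>I. real (n i) *\<^sub>R \<alpha> i)"
    by (intro sum.cong) auto
  then have "x = (\<Sum>i\<in>I. real (n i) *\<^sub>R \<alpha> i)"
    using simple_expansion[of x] by (rule trans[rotated])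
  then show "x \<in> nonneg_combs \<alpha>"
    unfolding nonneg_combs_def I_eq by blast
qed

lemma nonneg_combs_nonneg: "x \<in> nonneg_combs \<alpha> \<Longrightarrow> i \<in> I \<Longrightarrow> 0 \<le> x \<bullet> cw i"
  using nonneg_combs_iff Nats_altdef2 by auto

lemma nonneg_combs_add:
  "x \<in> nonneg_combs \<alpha> \<Longrightarrow> y \<in> nonneg_combs \<alpha> \<Longrightarrow> x + y \<in> nonneg_combs \<alpha>"
  by (simp add: nonneg_combs_iff inner_add_left Nats_add)

lemma zero_nonneg_combs: "0 \<in> nonneg_combs \<alpha>"
  by (simp add: nonneg_combs_iff)

lemma nonneg_combs_antisym:
  assumes "x \<in> nonneg_combs \<alpha>" "- x \<in> nonneg_combs \<alpha>"
  shows "x = 0"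
proof (rule eq_by_coords)
  fix i assume "i \<in> I"
  then show "x \<bullet> cw i = 0 \<bullet> cw i"
    using nonneg_combs_nonneg[OF assms(1), of i] nonneg_combs_nonneg[OF assms(2), of i] by simp
qed

lemma root_coord_int: "b \<in> \<Phi> \<Longrightarrow> i \<in> I \<Longrightarrow> b \<bullet> cw i \<in> \<int>"
proof -
  assume "b \<in> \<Phi>" "i \<in> I"
  then have "b \<bullet> cw i \<in> \<nat> \<or> - (b \<bullet> cw i) \<in> \<nat>"
    using root_signed[of b] by (auto simp: nonneg_combs_iff)
  then show ?thesis
    by (metis Ints_minus Nats_subset_Ints minus_minus subsetD)
qed

lemma pos_root: "b \<in> Pos \<Longrightarrow> b \<in> \<Phi>"
  by (simp add: positive_roots_def)

lemma pos_cases: "b \<in> \<Phi> \<Longrightarrow> b \<in> Pos \<or> - b \<in> Pos"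
  using root_signed root_uminus by (auto simp: positive_roots_def)

lemma pos_not_neg: "b \<in> Pos \<Longrightarrow> - b \<notin> Pos"
  using nonneg_combs_antisym root_nonzero by (auto simp: positive_roots_def)

lemma simple_pos: "i \<in> I \<Longrightarrow> \<alpha> i \<in> Pos"
  by (simp add: positive_roots_def simple_root nonneg_combs_iff simple_inner_cw)

lemma pos_if_coord_pos:
  assumes "b \<in> \<Phi>" "j \<in> I" "b \<bullet> cw j > 0"
  shows "b \<in> Pos"
  using assms root_signed[of b] nonneg_combs_nonneg[of "- b" j] by (auto simp: positive_roots_def)

text \<open>A positive root supported on \<open>\<alpha> i\<close> alone would be a multiple of it,
  and a reduced root system contains only the multiples by 1 and -1.\<close>

lemma pos_other_coord:
  assumes "b \<in> Pos" "i \<in> I" "b \<noteq> \<alpha> i"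
  shows "\<exists>j\<in>I. j \<noteq> i \<and> b \<bullet> cw j > 0"
proof (rule ccontr)
  assume nt: "\<not> ?thesis"
  have nn: "0 \<le> b \<bullet> cw j" if "j \<in> I" for j
    using nonneg_combs_nonneg that assms(1) by (simp add: positive_roots_def)
  have b: "b = (b \<bullet> cw i) *\<^sub>R \<alpha> i"
  proof (rule eq_by_coords)
    fix j assume "j \<in> I"
    then show "b \<bullet> cw j = ((b \<bullet> cw i) *\<^sub>R \<alpha> i) \<bullet> cw j"
      using nt nn[of j] assms(2) by (auto simp: simple_inner_cw)
  qed
  then have "(b \<bullet> cw i) *\<^sub>R \<alpha> i \<in> \<Phi>"
    using pos_root[OF assms(1)] by metis
  then have "b \<bullet> cw i = 1"
    using root_multiple[OF simple_root[OF assms(2)]] nn[OF assms(2)] by force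
  then show False using b assms(3) by (metis scaleR_one)
qed

text \<open>The reflection alters only the coordinate at \<open>i\<close>. A positive coordinate
  elsewhere survives, and since the coordinates of a root never have mixed signs, this one
  decides.\<close>

lemma simple_reflection_pos:
  assumes "b \<in> Pos" "i \<in> I" "b \<noteq> \<alpha> i"
  shows "s i b \<in> Pos"
proof -
  obtain j where j: "j \<in> I" "j \<noteq> i" "b \<bullet> cw j > 0"
    using pos_other_coord assms by blast
  then have "s i b \<bullet> cw j > 0"
    using assms(2) by (simp add: root_reflection_def inner_diff_left simple_inner_cw)
  then show ?thesis
    using pos_if_coord_pos j(1) root_reflection_root simple_root assms(2) pos_root[OF assms(1)] by blast
qed

definition ht :: "'a \<Rightarrow> real" where
  "ht x = (\<Sum>i\<in>I. x \<bullet> cw i)"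

lemma ht_linear: "ht (x + y) = ht x + ht y" "ht (x - y) = ht x - ht y" "ht (- x) = - ht x"
  "ht (c *\<^sub>R x) = c * ht x" "ht 0 = 0"
  by (simp_all add: ht_def inner_add_left inner_diff_left sum.distrib sum_subtractf sum_negf sum_distrib_left)

lemma ht_simple: "i \<in> I \<Longrightarrow> ht (\<alpha> i) = 1"
  by (simp add: ht_def simple_inner_cw finite_I)

lemma ht_nat: "x \<in> nonneg_combs \<alpha> \<Longrightarrow> ht x \<in> \<nat>"
  unfolding ht_def nonneg_combs_iff Nats_altdef2
  by (auto intro: Ints_sum sum_nonneg)

lemma ht_eq_0:
  assumes "x \<in> nonneg_combs \<alpha>" "ht x = 0"
  shows "x = 0"
proof (rule eq_by_coords)
  fix i assume "i \<in> I"
  then show "x \<bullet> cw i = 0 \<bullet> cw i"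
    using assms nonneg_combs_nonneg[OF assms(1)] unfolding ht_def
    by (subst (asm) sum_nonneg_eq_0_iff) (auto simp: finite_I)
qed

lemma ht_pos: "b \<in> Pos \<Longrightarrow> ht b \<ge> 1"
proof -
  assume b: "b \<in> Pos"
  then have "ht b \<in> \<nat>" "ht b \<noteq> 0"
    using ht_nat ht_eq_0 root_nonzero by (auto simp: positive_roots_def)
  then show ?thesis
    by (auto elim!: Nats_cases)
qed

lemma ht_eq_1:
  assumes "x \<in> nonneg_combs \<alpha>" "ht x = 1"
  shows "\<exists>i\<in>I. x = \<alpha> i"
proof -
  have "\<exists>i\<in>I. x \<bullet> cw i \<noteq> 0"
    using assms(2) unfolding ht_def by (metis (no_types, lifting) sum.neutral zero_neq_one)
  then obtain i where i: "i \<in> I" "x \<bullet> cw i \<noteq> 0" by blast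
  have nat: "x \<bullet> cw j \<in> \<nat>" if "j \<in> I" for j
    using assms(1) that by (simp add: nonneg_combs_iff)
  have "x \<bullet> cw i \<ge> 1" using i nat[of i] by (auto elim!: Nats_cases)
  then have "x - \<alpha> i \<in> nonneg_combs \<alpha>"
    using nat i by (auto simp: nonneg_combs_iff inner_diff_left simple_inner_cw Nats_diff)
  moreover have "ht (x - \<alpha> i) = 0"
    using assms(2) i(1) by (simp add: ht_linear ht_simple)
  ultimately show ?thesis using ht_eq_0 i(1) by fastforce
qed

text \<open>Reflecting a non-simple positive root in a simple root with which it has positive inner
  product lowers the height.\<close>

lemma pos_root_induct [consumes 1, case_names simple reflect]:
  assumes "b \<in> Pos"
    and simple: "\<And>i. i \<in> I \<Longrightarrow> P (\<alpha> i)"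
    and reflect: "\<And>i b. i \<in> I \<Longrightarrow> b \<in> Pos \<Longrightarrow> P b \<Longrightarrow> P (s i b)"
  shows "P b"
  using assms(1)
proof (induction "nat \<lfloor>ht b\<rfloor>" arbitrary: b rule: less_induct)
  case less
  show ?case
  proof (cases "\<exists>i\<in>I. b = \<alpha> i")
    case True
    then show ?thesis using simple by blast
  next
    case False
    have "0 < b \<bullet> b" using less.prems pos_root root_nonzero by simp
    \<comment> \<open>The expansion of \<open>b \<bullet> b\<close> over the simple roots has a
      positive sum, hence a positive term.\<close>
    then obtain i where i: "i \<in> I" "(b \<bullet> cw i) * (\<alpha> i \<bullet> b) > 0"
      using inner_expansion[of b b] sum_nonpos[of I "\<lambda>i. (b \<bullet> cw i) * (\<alpha> i \<bullet> b)"]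
      by (metis not_le)
    have "b \<bullet> cw i \<ge> 0"
      using nonneg_combs_nonneg[of b i] less.prems i(1) by (auto simp: positive_roots_def)
    with i(2) have "b \<bullet> \<alpha> i > 0"
      by (simp add: zero_less_mult_iff inner_commute)
    then have "b \<bullet> coroot (\<alpha> i) > 0"
      using simple_root[OF i(1)] root_nonzero by (simp add: inner_coroot)
    moreover obtain k where k: "b \<bullet> coroot (\<alpha> i) = of_int k"
      using cartan_integer[OF simple_root[OF i(1)] pos_root[OF less.prems]] Ints_cases by metis
    ultimately have "b \<bullet> coroot (\<alpha> i) \<ge> 1" by simp
    then have h: "ht (s i b) \<le> ht b - 1"
      using i(1) by (simp add: root_reflection_def ht_linear ht_simple)
    have pos: "s i b \<in> Pos" using simple_reflection_pos less.prems i False by blast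
    have "nat \<lfloor>ht (s i b)\<rfloor> < nat \<lfloor>ht b\<rfloor>"
      using h ht_pos[OF pos] by linarith
    then have "P (s i (s i b))"
      using reflect[OF i(1) pos less.hyps[OF _ pos]] by blast
    then show ?thesis by simp
  qed
qed

subsection \<open>The Weyl group\<close>

lemma weyl_orthogonal: "w \<in> W \<Longrightarrow> orthogonal_transformation w"
proof (induction rule: weyl_group.induct)
  case weyl_id
  show ?case using orthogonal_transformation_id by (simp add: id_def)
next
  case (weyl_step w a)
  then show ?case
    by (intro orthogonal_transformation_compose orthogonal_root_reflection)
qed

lemma weyl_linear: "w \<in> W \<Longrightarrow> linear w"
  using weyl_orthogonal orthogonal_transformation_def by blast

lemma weyl_root: "w \<in> W \<Longrightarrow> b \<in> \<Phi> \<Longrightarrow> w b \<in> \<Phi>"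
  by (induction rule: weyl_group.induct) (auto simp: root_reflection_root)

lemma weyl_reflection: "a \<in> \<Phi> \<Longrightarrow> root_reflection a \<in> W"
  using weyl_step[OF weyl_id] by simp

lemma weyl_comp: "v \<in> W \<Longrightarrow> w \<in> W \<Longrightarrow> v \<circ> w \<in> W"
  by (induction rule: weyl_group.induct) (auto simp: comp_assoc intro: weyl_step)

lemma weyl_two_sided_inverse: "w \<in> W \<Longrightarrow> \<exists>v\<in>W. v \<circ> w = id \<and> w \<circ> v = id"
proof (induction rule: weyl_group.induct)
  case weyl_id
  show ?case by (rule bexI[of _ id]) (simp_all add: weyl_group.weyl_id)
next
  case (weyl_step w a)
  then obtain v where v: "v \<in> W" "v \<circ> w = id" "w \<circ> v = id" by blast
  then have "v \<circ> root_reflection a \<in> W"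
    using weyl_comp weyl_reflection weyl_step.hyps by blast
  moreover have "v (w x) = x" "w (v x) = x" for x
    using v by (simp_all add: fun_eq_iff)
  ultimately show ?case
    by (intro bexI[of _ "v \<circ> root_reflection a"]) (auto simp: fun_eq_iff)
qed

lemma weyl_inv: "w \<in> W \<Longrightarrow> inv w \<in> W"
  and weyl_inv_left: "w \<in> W \<Longrightarrow> inv w (w x) = x"
  and weyl_inv_right: "w \<in> W \<Longrightarrow> w (inv w x) = x"
proof -
  assume "w \<in> W"
  then obtain v where v: "v \<in> W" "v \<circ> w = id" "w \<circ> v = id"
    using weyl_two_sided_inverse by blast
  then have "inv w = v" using inv_unique_comp by blast
  then show "inv w \<in> W" "inv w (w x) = x" "w (inv w x) = x"
    using v(1) fun_cong[OF v(2), of x] fun_cong[OF v(3), of x] by simp_all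
qed

lemma weyl_inv_inner: "w \<in> W \<Longrightarrow> b \<bullet> w x = inv w b \<bullet> x"
  using weyl_orthogonal[of w] weyl_inv_right[of w b] unfolding orthogonal_transformation_def by metis

text \<open>The roots span, so an element of W is determined by how it maps the finite set of roots
  to itself.\<close>

lemma finite_weyl: "finite W"
proof (rule finite_imageD)
  show "finite ((\<lambda>w. restrict w \<Phi>) ` W)"
    by (rule finite_subset[of _ "\<Phi> \<rightarrow>\<^sub>E \<Phi>"]) (auto simp: weyl_root finite_roots intro!: finite_PiE)
  show "inj_on (\<lambda>w. restrict w \<Phi>) W"
  proof (rule inj_onI)
    fix v w assume vw: "v \<in> W" "w \<in> W" "restrict v \<Phi> = restrict w \<Phi>"
    have "v x = w x" for x
    proof (rule linear_eq_on_span[of v w \<Phi>])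
      show "v b = w b" if "b \<in> \<Phi>" for b
        using that vw(3) by (metis restrict_apply')
    qed (use vw weyl_linear span_roots in auto)
    then show "v = w" by blast
  qed
qed

section \<open>Words in the simple reflections and the exchange condition\<close>

definition word :: "nat list \<Rightarrow> 'a \<Rightarrow> 'a" where
  "word js = foldr (\<lambda>j w. s j \<circ> w) js id"

lemma word_simps [simp]: "word [] = id" "word (j # js) = s j \<circ> word js"
  by (simp_all add: word_def)

lemma word_append [simp]: "word (js @ ks) = word js \<circ> word ks"
  by (induction js) (simp_all add: comp_assoc)

lemma word_weyl: "set js \<subseteq> I \<Longrightarrow> word js \<in> W"
  by (induction js) (auto intro: weyl_id weyl_step simple_root)

text \<open>Apply the letters to \<open>\<alpha> i\<close> from the right. The root starts positive
  and ends negative, and \<open>s j\<close> makes no positive root but \<open>\<alpha> j\<close>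
  negative. So at some letter \<open>j\<close> the letters to its right, with product
  \<open>v\<close>, send \<open>\<alpha> i\<close> to \<open>\<alpha> j\<close>; then
  \<open>v \<circ> s i = s j \<circ> v\<close>, and composing with \<open>s i\<close> deletes that
  letter.\<close>

lemma exchange:
  assumes "set js \<subseteq> I" "i \<in> I" "word js (\<alpha> i) \<notin> Pos"
  shows "\<exists>ks. set ks \<subseteq> I \<and> length js = Suc (length ks) \<and> word ks = word js \<circ> s i"
  using assms(1,3)
proof (induction js)
  case Nil
  then show ?case using simple_pos assms(2) by simp
next
  case (Cons j js)
  let ?v = "word js"
  show ?case
  proof (cases "?v (\<alpha> i) \<in> Pos")
    case False
    then obtain ks where "set ks \<subseteq> I" "length js = Suc (length ks)" "word ks = ?v \<circ> s i"
      using Cons.IH Cons.prems(1) False by (meson set_subset_Cons subset_trans)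
    then show ?thesis
      using Cons.prems(1) by (intro exI[of _ "j # ks"]) (simp add: comp_assoc)
  next
    case True
    then have j: "?v (\<alpha> i) = \<alpha> j"
      using Cons.prems simple_reflection_pos[of "?v (\<alpha> i)" j] by auto
    have "orthogonal_transformation ?v"
      using Cons.prems(1) word_weyl weyl_orthogonal by simp
    then have "?v (s i x) = s j (?v x)" for x
      using orthogonal_conjugate_reflection[of ?v "\<alpha> i" x] j by simp
    then show ?thesis
      using Cons.prems(1) by (intro exI[of _ js]) (auto simp: fun_eq_iff)
  qed
qed

text \<open>If \<open>i\<close> is the last letter and the rest is \<open>ks\<close>, then
  \<open>word ks\<close> sends \<open>\<alpha> i\<close> to a negative root, and the exchange
  rewrites the whole product with two letters fewer.\<close>

lemma word_eq_id:
  assumes "set js \<subseteq> I" "\<And>i. i \<in> I \<Longrightarrow> word js (\<alpha> i) \<in> Pos"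
  shows "word js = id"
  using assms
proof (induction "length js" arbitrary: js rule: less_induct)
  case less
  show ?case
  proof (cases js rule: rev_cases)
    case Nil
    then show ?thesis by simp
  next
    case (snoc ks i)
    then have i: "i \<in> I" and ks: "set ks \<subseteq> I" using less.prems by auto
    have "word ks (- \<alpha> i) \<in> Pos"
      using less.prems(2)[OF i] snoc simple_root[OF i] by (simp add: root_reflection_self root_nonzero)
    then have "- word ks (\<alpha> i) \<in> Pos"
      using weyl_linear[OF word_weyl[OF ks]] by (simp add: linear_neg)
    then have "word ks (\<alpha> i) \<notin> Pos" using pos_not_neg by force
    then obtain ls where "set ls \<subseteq> I" "length ks = Suc (length ls)" "word ls = word ks \<circ> s i"
      using exchange[OF ks i] by blast
    moreover from this have "word ls = word js" using snoc by simp
    ultimately show ?thesis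
      using less.hyps[of ls] less.prems(2) snoc by simp
  qed
qed

text \<open>Conjugating the reflection in \<open>b\<close> by \<open>s i\<close> gives the
  reflection in \<open>s i b\<close>, and simple reflections reach every positive root from a simple
  one.\<close>

lemma reflection_word: "b \<in> Pos \<Longrightarrow> \<exists>js. set js \<subseteq> I \<and> word js = root_reflection b"
proof (induction rule: pos_root_induct)
  case (simple i)
  then show ?case by (intro exI[of _ "[i]"]) simp
next
  case (reflect i b)
  then obtain js where js: "set js \<subseteq> I" "word js = root_reflection b" by blast
  have "root_reflection (s i b) x = s i (root_reflection b (s i x))" for x
    using orthogonal_conjugate_reflection[OF orthogonal_root_reflection, of "\<alpha> i" b "s i x"] by simp
  then show ?case
    using js reflect(1) by (intro exI[of _ "i # js @ [i]"]) (auto simp: fun_eq_iff)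
qed

lemma weyl_word: "w \<in> W \<Longrightarrow> \<exists>js. set js \<subseteq> I \<and> word js = w"
proof (induction rule: weyl_group.induct)
  case weyl_id
  show ?case by (intro exI[of _ "[]"]) simp
next
  case (weyl_step w a)
  have "\<exists>js. set js \<subseteq> I \<and> word js = root_reflection a"
    using pos_cases[OF weyl_step.hyps(2)] reflection_word root_reflection_uminus by metis
  then obtain js ks where "set js \<subseteq> I" "word js = root_reflection a" "set ks \<subseteq> I" "word ks = w"
    using weyl_step.IH by blast
  then show ?case by (intro exI[of _ "js @ ks"]) simp
qed

lemma weyl_preserving_pos: "w \<in> W \<Longrightarrow> (\<And>i. i \<in> I \<Longrightarrow> w (\<alpha> i) \<in> Pos) \<Longrightarrow> w = id"
  using weyl_word word_eq_id by metis

text \<open>The product of the two Cartan integers is four times a squared cosine, hence below 4 for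
  non-proportional roots. Two positive integers with product below 4 are not both at least
  2.\<close>

lemma cartan_eq_1:
  assumes "a \<in> \<Phi>" "b \<in> \<Phi>" "a \<bullet> b > 0" "a \<noteq> b"
  shows "a \<bullet> coroot b = 1 \<or> b \<bullet> coroot a = 1"
proof -
  obtain m n :: int where m: "a \<bullet> coroot b = of_int m" and n: "b \<bullet> coroot a = of_int n"
    using assms cartan_integer Ints_cases by metis
  have ab: "a \<bullet> a > 0" "b \<bullet> b > 0" using assms root_nonzero by auto
  have pos: "m > 0" "n > 0"
  proof -
    have "a \<bullet> coroot b > 0" "b \<bullet> coroot a > 0"
      using ab assms(3) by (simp_all add: inner_coroot inner_commute[of b a])
    then show "m > 0" "n > 0" using m n by simp_all
  qed
  have "real_of_int (m * n) = 4 * (a \<bullet> b)\<^sup>2 / ((a \<bullet> a) * (b \<bullet> b))"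
    by (simp add: m[symmetric] n[symmetric] inner_coroot inner_commute[of b a] power2_eq_square)
  \<comment> \<open>Equality in Cauchy-Schwarz together with a positive inner product would make
    \<open>b\<close> a positive multiple of \<open>a\<close>, hence equal to
    \<open>a\<close>.\<close>
  moreover have "(a \<bullet> b)\<^sup>2 < (a \<bullet> a) * (b \<bullet> b)"
  proof (rule ccontr)
    assume "\<not> ?thesis"
    then have "(a \<bullet> b)\<^sup>2 = (a \<bullet> a) * (b \<bullet> b)"
      using Cauchy_Schwarz_ineq[of a b] by simp
    then have "(norm a * norm b)\<^sup>2 = (a \<bullet> b)\<^sup>2"
      by (simp add: power_mult_distrib power2_norm_eq_inner)
    then have "a \<bullet> b = norm a * norm b"
      using assms(3) by (simp add: power2_eq_iff_nonneg)
    then have "norm a *\<^sub>R b = norm b *\<^sub>R a"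
      using norm_cauchy_schwarz_eq by blast
    then have "(1 / norm a) *\<^sub>R (norm a *\<^sub>R b) = (1 / norm a) *\<^sub>R (norm b *\<^sub>R a)"
      by (rule arg_cong)
    then have b: "b = (norm b / norm a) *\<^sub>R a"
      using ab by simp
    then have "norm b / norm a = 1 \<or> norm b / norm a = - 1"
      using root_multiple assms(1,2) by metis
    moreover have "norm b / norm a \<ge> 0" by simp
    ultimately have "norm b / norm a = 1" by linarith
    then show False using b assms(4) by (metis scaleR_one)
  qed
  ultimately have "real_of_int (m * n) < 4" using ab by (simp add: divide_less_eq)
  then have "m * n < 4" by linarith
  then have "m = 1 \<or> n = 1"
    using pos mult_mono[of 2 m 2 n] by (cases "m = 1"; cases "n = 1") auto
  then show ?thesis using m n by auto
qed

lemma root_diff: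
  assumes "a \<in> \<Phi>" "b \<in> \<Phi>" "a \<bullet> b > 0" "a \<noteq> b"
  shows "a - b \<in> \<Phi>"
proof -
  consider "a \<bullet> coroot b = 1" | "b \<bullet> coroot a = 1" using cartan_eq_1 assms by blast
  then show ?thesis
  proof cases
    case 1
    then show ?thesis using root_reflection_root[OF assms(2,1)] by (simp add: root_reflection_def)
  next
    case 2
    then show ?thesis
      using root_uminus[OF root_reflection_root[OF assms(1,2)]] by (simp add: root_reflection_def)
  qed
qed

text \<open>Passing to \<open>- b\<close> shows that one of the two Cartan integers is -1. The
  corresponding reflection adds one coroot to the other, and it carries coroots to coroots.\<close>

lemma coroot_add:
  assumes "a \<in> \<Phi>" "b \<in> \<Phi>" "a \<bullet> b < 0" "a \<noteq> - b"
  shows "\<exists>c\<in>\<Phi>. coroot c = coroot a + coroot b"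
proof -
  have *: "\<exists>c\<in>\<Phi>. coroot c = coroot x + coroot y"
    if "x \<in> \<Phi>" "y \<in> \<Phi>" "x \<bullet> coroot y = - 1" for x y
  proof -
    have "coroot (root_reflection x y) = root_reflection x (coroot y)"
      by (rule orthogonal_coroot[OF orthogonal_root_reflection])
    also have "\<dots> = coroot y + coroot x"
      using that(3) by (simp add: root_reflection_swap inner_commute)
    finally show ?thesis using root_reflection_root that by (metis add.commute)
  qed
  have "a \<bullet> coroot (- b) = 1 \<or> - b \<bullet> coroot a = 1"
    using cartan_eq_1[of a "- b"] assms root_uminus by simp
  then have "a \<bullet> coroot b = - 1 \<or> b \<bullet> coroot a = - 1"
    by (auto simp: coroot_uminus)
  then show ?thesis using *[of a b] *[of b a] assms by (auto simp: add.commute)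
qed

subsection \<open>Coweights and coroots\<close>

lemma coweight_iff: "x \<in> Z \<longleftrightarrow> (\<forall>i\<in>I. \<alpha> i \<bullet> x \<in> \<int>)"
  by (simp add: coweight_lattice_def I_eq)

lemma root_coweight_int: "b \<in> \<Phi> \<Longrightarrow> x \<in> Z \<Longrightarrow> b \<bullet> x \<in> \<int>"
  unfolding inner_expansion[of b x]
  by (intro Ints_sum Ints_mult) (auto simp: root_coord_int coweight_iff)

lemma coweight_diff: "x \<in> Z \<Longrightarrow> y \<in> Z \<Longrightarrow> x - y \<in> Z"
  by (simp add: coweight_iff inner_diff_right Ints_diff)

lemma coweight_add: "x \<in> Z \<Longrightarrow> y \<in> Z \<Longrightarrow> x + y \<in> Z"
  by (simp add: coweight_iff inner_add_right Ints_add)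

lemma coweight_uminus: "x \<in> Z \<Longrightarrow> - x \<in> Z"
  by (simp add: coweight_iff)

lemma coweight_weyl: "x \<in> Z \<Longrightarrow> w \<in> W \<Longrightarrow> w x \<in> Z"
  by (simp add: coweight_iff weyl_inv_inner root_coweight_int weyl_root weyl_inv simple_root)

lemma coroot_lattice_zero: "0 \<in> Q"
  unfolding coroot_lattice_def by (auto intro!: exI[of _ "\<lambda>_. 0"])

lemma coroot_lattice_add: "x \<in> Q \<Longrightarrow> y \<in> Q \<Longrightarrow> x + y \<in> Q"
proof -
  assume "x \<in> Q" "y \<in> Q"
  then obtain m n :: "'a \<Rightarrow> int" where
    "x = (\<Sum>b\<in>\<Phi>. of_int (m b) *\<^sub>R coroot b)" "y = (\<Sum>b\<in>\<Phi>. of_int (n b) *\<^sub>R coroot b)"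
    unfolding coroot_lattice_def by blast
  then have "x + y = (\<Sum>b\<in>\<Phi>. of_int (m b + n b) *\<^sub>R coroot b)"
    by (simp add: scaleR_add_left sum.distrib)
  then show ?thesis unfolding coroot_lattice_def mem_Collect_eq by (rule exI[of _ "\<lambda>b. m b + n b"])
qed

lemma coroot_lattice_uminus: "x \<in> Q \<Longrightarrow> - x \<in> Q"
proof -
  assume "x \<in> Q"
  then obtain n :: "'a \<Rightarrow> int" where "x = (\<Sum>b\<in>\<Phi>. of_int (n b) *\<^sub>R coroot b)"
    unfolding coroot_lattice_def by blast
  then have "- x = (\<Sum>b\<in>\<Phi>. of_int (- n b) *\<^sub>R coroot b)"
    by (simp add: sum_negf)
  then show ?thesis unfolding coroot_lattice_def mem_Collect_eq by (rule exI[of _ "\<lambda>b. - n b"])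
qed

lemma coroot_multiple: "b \<in> \<Phi> \<Longrightarrow> of_int k *\<^sub>R coroot b \<in> Q"
proof -
  assume b: "b \<in> \<Phi>"
  have "(\<Sum>c\<in>\<Phi>. of_int (if c = b then k else 0) *\<^sub>R coroot c)
      = (\<Sum>c\<in>\<Phi>. if c = b then of_int k *\<^sub>R coroot b else 0)"
    by (intro sum.cong) auto
  also have "\<dots> = of_int k *\<^sub>R coroot b" using b finite_roots by simp
  finally show ?thesis
    unfolding coroot_lattice_def mem_Collect_eq
    by (intro exI[of _ "\<lambda>c. if c = b then k else 0"]) (rule sym)
qed

lemma coroot_lattice_sum: "(\<And>b. b \<in> A \<Longrightarrow> f b \<in> Q) \<Longrightarrow> sum f A \<in> Q"
  by (induction A rule: infinite_finite_induct) (auto intro: coroot_lattice_zero coroot_lattice_add)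

lemma coroot_lattice_weyl:
  assumes "x \<in> Q" "w \<in> W"
  shows "w x \<in> Q"
proof -
  obtain n :: "'a \<Rightarrow> int" where x: "x = (\<Sum>b\<in>\<Phi>. of_int (n b) *\<^sub>R coroot b)"
    using assms(1) unfolding coroot_lattice_def by blast
  have "w x = (\<Sum>b\<in>\<Phi>. of_int (n b) *\<^sub>R coroot (w b))"
    unfolding x orthogonal_coroot[OF weyl_orthogonal[OF assms(2)]]
    by (simp add: linear_sum[OF weyl_linear[OF assms(2)]] linear_cmul[OF weyl_linear[OF assms(2)]])
  also have "\<dots> \<in> Q"
    by (rule coroot_lattice_sum) (rule coroot_multiple[OF weyl_root[OF assms(2)]])
  finally show ?thesis .
qed

lemma coroot_lattice_coweight:
  assumes "x \<in> Q"
  shows "x \<in> Z"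
proof -
  obtain n :: "'a \<Rightarrow> int" where x: "x = (\<Sum>b\<in>\<Phi>. of_int (n b) *\<^sub>R coroot b)"
    using assms unfolding coroot_lattice_def by blast
  show ?thesis
    unfolding coweight_iff x inner_sum_right
    by (auto intro!: Ints_sum Ints_mult cartan_integer simple_root)
qed

text \<open>A negative multiple of a coroot is a positive multiple of the coroot of the opposite
  root. The list form provides a number of summands that can be minimised.\<close>

lemma coroot_lattice_list: "x \<in> Q \<Longrightarrow> \<exists>bs. set bs \<subseteq> \<Phi> \<and> sum_list (map coroot bs) = x"
proof -
  let ?L = "{x. \<exists>bs. set bs \<subseteq> \<Phi> \<and> sum_list (map coroot bs) = x}"
  have zero: "0 \<in> ?L" by (auto intro!: exI[of _ "[]"])
  have add: "x + y \<in> ?L" if xy: "x \<in> ?L" "y \<in> ?L" for x y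
  proof -
    obtain bs cs where "set bs \<subseteq> \<Phi>" "sum_list (map coroot bs) = x"
      "set cs \<subseteq> \<Phi>" "sum_list (map coroot cs) = y" using xy by blast
    then show ?thesis by (auto intro!: exI[of _ "bs @ cs"])
  qed
  have nat: "of_nat k *\<^sub>R coroot b \<in> ?L" if "b \<in> \<Phi>" for b k
  proof (induction k)
    case 0
    then show ?case using zero by simp
  next
    case (Suc k)
    have "coroot b \<in> ?L" using that by (auto intro!: exI[of _ "[b]"])
    from add[OF this Suc] show ?case by (simp add: scaleR_add_left)
  qed
  have int: "of_int k *\<^sub>R coroot b \<in> ?L" if "b \<in> \<Phi>" for b k
  proof (cases "k \<ge> 0")
    case True
    then show ?thesis using nat[OF that, of "nat k"] by simp
  next
    case False
    then show ?thesis using nat[OF root_uminus[OF that], of "nat (- k)"] by (simp add: coroot_uminus)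
  qed
  have sum: "sum f A \<in> ?L" if "\<And>b. b \<in> A \<Longrightarrow> f b \<in> ?L" for f :: "'a \<Rightarrow> 'a" and A
    using that
  proof (induction A rule: infinite_finite_induct)
    case (insert x F)
    then show ?case using add[of "f x" "sum f F"] by (simp only: sum.insert insert_iff) simp
  qed (use zero in \<open>simp_all\<close>)
  assume "x \<in> Q"
  then obtain n :: "'a \<Rightarrow> int" where x: "x = (\<Sum>b\<in>\<Phi>. of_int (n b) *\<^sub>R coroot b)"
    unfolding coroot_lattice_def by blast
  have "x \<in> ?L" unfolding x by (rule sum) (rule int)
  then show ?thesis by simp
qed

text \<open>Write \<open>g\<close> as a sum of as few coroots as possible. Two of them with negative inner product
  could be merged or cancelled, so the root \<open>b\<close> of any coroot in the sum has \<open>b \<bullet> g \<ge> 2\<close>.\<close>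

lemma coroot_lattice_small:
  assumes "g \<in> Q" "\<And>b. b \<in> \<Phi> \<Longrightarrow> b \<bullet> g \<le> 1"
  shows "g = 0"
proof -
  let ?P = "\<lambda>bs. set bs \<subseteq> \<Phi> \<and> sum_list (map coroot bs) = g"
  obtain bs where bs: "?P bs" and min: "\<And>cs. ?P cs \<Longrightarrow> length bs \<le> length cs"
    using coroot_lattice_list[OF assms(1)] ex_has_least_nat[of ?P _ length] by blast
  show ?thesis
  proof (cases bs)
    case Nil
    then show ?thesis using bs by simp
  next
    case (Cons b cs)
    have b: "b \<in> \<Phi>" and cs: "set cs \<subseteq> \<Phi>" and g: "g = coroot b + sum_list (map coroot cs)"
      using bs Cons by auto
    have nn: "b \<bullet> coroot c \<ge> 0" if c: "c \<in> set cs" for c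
    proof (rule ccontr)
      assume "\<not> ?thesis"
      then have "b \<bullet> c < 0"
        by (simp add: inner_coroot divide_less_0_iff not_le)
          (smt (verit) inner_ge_zero mult_nonneg_nonneg)
      let ?ds = "remove1 c cs"
      have ds: "sum_list (map coroot cs) = coroot c + sum_list (map coroot ?ds)"
        using c by (rule sum_list_map_remove1)
      have setds: "set ?ds \<subseteq> \<Phi>" using set_remove1_subset cs by fast
      have len: "length ?ds < length cs" using c length_pos_if_in_set[OF c] by (simp add: length_remove1)
      have cr: "c \<in> \<Phi>" using c cs by blast
      show False
      proof (cases "b = - c")
        case True
        then have "?P ?ds" using g ds setds by (simp add: coroot_uminus)
        then show False using min[of ?ds] len Cons by simp
      next
        case False
        then obtain d where "d \<in> \<Phi>" "coroot d = coroot b + coroot c"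
          using coroot_add[OF b cr \<open>b \<bullet> c < 0\<close>] by blast
        then have "?P (d # ?ds)" using g ds setds by simp
        then show False using min[of "d # ?ds"] len Cons by simp
      qed
    qed
    have "b \<bullet> sum_list (map coroot cs) \<ge> 0"
      using nn by (induction cs) (auto simp: inner_add_right)
    then have "b \<bullet> g \<ge> 2"
      using g coroot_inner_self[OF root_nonzero[OF b]] by (simp add: inner_add_right)
    then show ?thesis using assms(2)[OF b] by simp
  qed
qed

subsection \<open>The highest root\<close>

text \<open>Otherwise the difference of the two simple roots would be a root with coordinates 1 and
  -1.\<close>

lemma simple_obtuse:
  assumes "i \<in> I" "j \<in> I" "i \<noteq> j"
  shows "\<alpha> i \<bullet> \<alpha> j \<le> 0"
proof (rule ccontr)
  assume "\<not> ?thesis"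
  moreover have "\<alpha> i \<noteq> \<alpha> j" using assms simple_inj by (auto dest: inj_onD)
  ultimately have r: "\<alpha> i - \<alpha> j \<in> \<Phi>" using root_diff simple_root assms by simp
  have "(\<alpha> i - \<alpha> j) \<bullet> cw i = 1" "(\<alpha> i - \<alpha> j) \<bullet> cw j = - 1"
    using assms by (simp_all add: inner_diff_left simple_inner_cw)
  then show False
    using root_signed[OF r] nonneg_combs_nonneg[of "\<alpha> i - \<alpha> j" j]
      nonneg_combs_nonneg[of "- (\<alpha> i - \<alpha> j)" i] assms(1,2) by (auto simp: inner_diff_left)
qed

text \<open>\<open>highest_root\<close> asks for a greatest root in the order given by
  \<open>nonneg_combs\<close>. Maximal roots exist by finiteness; irreducibility leaves only one of
  them, which is then the greatest.\<close>

definition maximal_root :: "'a \<Rightarrow> bool" where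
  "maximal_root m \<longleftrightarrow> m \<in> \<Phi> \<and> (\<forall>c\<in>\<Phi>. c - m \<in> nonneg_combs \<alpha> \<longrightarrow> c = m)"

text \<open>A root of largest height among those above \<open>b\<close> is maximal, because the
  height strictly increases along the order.\<close>

lemma maximal_root_above:
  assumes "b \<in> \<Phi>"
  shows "\<exists>m. maximal_root m \<and> m - b \<in> nonneg_combs \<alpha>"
proof -
  let ?S = "{c\<in>\<Phi>. c - b \<in> nonneg_combs \<alpha>}"
  have "finite ?S" "?S \<noteq> {}" using assms finite_roots zero_nonneg_combs by auto
  then have "Max (ht ` ?S) \<in> ht ` ?S" by simp
  then obtain m where m: "m \<in> ?S" "ht m = Max (ht ` ?S)" by (metis (no_types, lifting) imageE)
  have le: "ht c \<le> ht m" if "c \<in> ?S" for c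
    unfolding m(2) using that finite_roots by simp
  have "c = m" if c: "c \<in> \<Phi>" "c - m \<in> nonneg_combs \<alpha>" for c
  proof -
    have "c \<in> ?S" using c m(1) nonneg_combs_add[of "c - m" "m - b"] by simp
    then have "ht (c - m) \<le> 0" using le by (simp add: ht_linear)
    moreover have "ht (c - m) \<ge> 0" using ht_nat[OF c(2)] by (auto elim: Nats_cases)
    ultimately show ?thesis using ht_eq_0[OF c(2)] by simp
  qed
  then show ?thesis using m(1) unfolding maximal_root_def by blast
qed

text \<open>If \<open>m\<close> were negative, \<open>- m\<close> would lie above it.\<close>

lemma maximal_root_pos:
  assumes "maximal_root m"
  shows "m \<in> Pos"
proof (rule ccontr)
  assume "m \<notin> Pos"
  then have "- m \<in> Pos" using assms pos_cases by (auto simp: maximal_root_def)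
  then have "- m - m \<in> nonneg_combs \<alpha>" "- m \<in> \<Phi>"
    using nonneg_combs_add[of "- m" "- m"] by (auto simp: positive_roots_def)
  then have "- m = m" using assms by (simp add: maximal_root_def)
  then have "2 *\<^sub>R m = 0" by (metis add.right_inverse scaleR_2)
  then show False
    using assms root_nonzero by (auto simp: maximal_root_def)
qed

text \<open>If the inner product were negative, \<open>m + \<alpha> i\<close> would be a root above
  \<open>m\<close>.\<close>

lemma maximal_root_dominant:
  assumes "maximal_root m" "i \<in> I"
  shows "\<alpha> i \<bullet> m \<ge> 0"
proof (rule ccontr)
  assume "\<not> ?thesis"
  then have "m \<bullet> (- \<alpha> i) > 0" by (simp add: inner_commute)
  moreover have "m \<noteq> - \<alpha> i"
    using maximal_root_pos[OF assms(1)] pos_not_neg simple_pos[OF assms(2)] by metis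
  moreover have "m \<in> \<Phi>" "- \<alpha> i \<in> \<Phi>"
    using assms root_uminus simple_root by (auto simp: maximal_root_def)
  ultimately have "m + \<alpha> i \<in> \<Phi>" using root_diff[of m "- \<alpha> i"] by simp
  moreover have "m + \<alpha> i - m \<in> nonneg_combs \<alpha>"
    using simple_pos[OF assms(2)] by (simp add: positive_roots_def)
  ultimately have "m + \<alpha> i = m" using assms(1) unfolding maximal_root_def by blast
  then show False using root_nonzero[OF simple_root[OF assms(2)]] by simp
qed

section \<open>Irreducibility as connectedness of the Dynkin diagram\<close>

definition roots_over :: "nat set \<Rightarrow> 'a set" where
  "roots_over J = {b\<in>\<Phi>. \<forall>i\<in>I - J. b \<bullet> cw i = 0}"

lemma roots_over_reflection:
  assumes "b \<in> roots_over J" "i \<in> I" "\<And>i k. i \<in> J \<Longrightarrow> k \<in> I - J \<Longrightarrow> \<alpha> i \<bullet> \<alpha> k = 0"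
  shows "s i b \<in> roots_over J"
proof (cases "i \<in> J")
  case True
  then show ?thesis
    using assms(1,2) root_reflection_root[OF simple_root[OF assms(2)]]
    by (auto simp: roots_over_def root_reflection_def inner_diff_left simple_inner_cw)
next
  case False
  have "(b \<bullet> cw j) * (\<alpha> j \<bullet> \<alpha> i) = 0" if "j \<in> I" for j
    using that assms False by (cases "j \<in> J") (auto simp: roots_over_def)
  then have "b \<bullet> \<alpha> i = 0" unfolding inner_expansion[of b "\<alpha> i"] by (rule sum.neutral[OF ballI])
  then show ?thesis using assms(1) by (simp add: root_reflection_def inner_coroot)
qed

text \<open>Simple reflections preserve both sets when \<open>J\<close> is orthogonal to its
  complement, and from the simple roots they reach every positive root.\<close>

lemma roots_over_partition:
  assumes "J \<subseteq> I" "\<And>i k. i \<in> J \<Longrightarrow> k \<in> I - J \<Longrightarrow> \<alpha> i \<bullet> \<alpha> k = 0"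
  shows "roots_over J \<union> roots_over (I - J) = \<Phi>"
proof -
  have sym: "\<alpha> i \<bullet> \<alpha> k = 0" if "i \<in> I - J" "k \<in> I - (I - J)" for i k
    using assms(2)[of k i] that by (auto simp: inner_commute)
  have pos: "b \<in> roots_over J \<union> roots_over (I - J)" if "b \<in> Pos" for b
    using that
  proof (induction rule: pos_root_induct)
    case (simple i)
    then show ?case
      by (cases "i \<in> J") (auto simp: roots_over_def simple_root simple_inner_cw)
  next
    case (reflect i b)
    then show ?case
      using roots_over_reflection[OF _ reflect(1) assms(2)] roots_over_reflection[OF _ reflect(1) sym]
      by blast
  qed
  have neg: "- b \<in> roots_over K" if "b \<in> roots_over K" for b K
    using that root_uminus by (auto simp: roots_over_def)
  show ?thesis
  proof (rule set_eqI)
    fix b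
    show "b \<in> roots_over J \<union> roots_over (I - J) \<longleftrightarrow> b \<in> \<Phi>"
      using pos[of b] pos[of "- b"] neg[of "- b"] pos_cases[of b] by (auto simp: roots_over_def)
  qed
qed

end

locale irreducible_root_basis = root_basis +
  assumes irreducible: "irreducible_roots \<Phi>"
begin

text \<open>A proper \<open>J\<close> would split the roots into those over \<open>J\<close> and
  those over \<open>I - J\<close>, two nonempty, disjoint and mutually orthogonal sets.\<close>

lemma simple_connected:
  assumes "J \<subseteq> I" "J \<noteq> {}" "\<And>i k. i \<in> J \<Longrightarrow> k \<in> I - J \<Longrightarrow> \<alpha> i \<bullet> \<alpha> k = 0"
  shows "J = I"
proof (rule ccontr)
  assume "J \<noteq> I"
  then obtain k where k: "k \<in> I - J" using assms(1) by blast
  obtain j where j: "j \<in> J" using assms(2) by blast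
  let ?A = "roots_over J" and ?B = "roots_over (I - J)"
  have ne: "?A \<noteq> {}" "?B \<noteq> {}"
  proof -
    have "\<alpha> j \<in> ?A" "\<alpha> k \<in> ?B"
      using j k assms(1) by (auto simp: roots_over_def simple_root simple_inner_cw)
    then show "?A \<noteq> {}" "?B \<noteq> {}" by blast+
  qed
  have disj: "?A \<inter> ?B = {}"
  proof (rule equals0I)
    fix b assume b: "b \<in> ?A \<inter> ?B"
    then have "b = 0" by (intro eq_by_coords) (auto simp: roots_over_def)
    then show False using b root_nonzero by (auto simp: roots_over_def)
  qed
  have orth: "a \<bullet> b = 0" if ab: "a \<in> ?A" "b \<in> ?B" for a b
  proof -
    have "\<alpha> i \<bullet> b = 0" if i: "i \<in> J" for i
    proof -
      have "(b \<bullet> cw l) * (\<alpha> l \<bullet> \<alpha> i) = 0" if "l \<in> I" for l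
        using that ab(2) assms(3)[OF i, of l] i by (cases "l \<in> J") (auto simp: roots_over_def inner_commute)
      then show ?thesis unfolding inner_commute[of _ b] inner_expansion[of b "\<alpha> i"]
        by (rule sum.neutral[OF ballI])
    qed
    then have "(a \<bullet> cw i) * (\<alpha> i \<bullet> b) = 0" if "i \<in> I" for i
      using that ab(1) by (cases "i \<in> J") (auto simp: roots_over_def)
    then show ?thesis unfolding inner_expansion[of a b] by (rule sum.neutral[OF ballI])
  qed
  have un: "?A \<union> ?B = \<Phi>" using roots_over_partition assms(1,3) by blast
  have "\<exists>A B. A \<noteq> {} \<and> B \<noteq> {} \<and> A \<inter> B = {} \<and> A \<union> B = \<Phi> \<and> (\<forall>a\<in>A. \<forall>b\<in>B. a \<bullet> b = 0)"
    by (rule exI[of _ ?A], rule exI[of _ ?B]) (use ne disj un orth in auto)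
  then show False using irreducible unfolding irreducible_roots_def by simp
qed

text \<open>For \<open>k\<close> outside the support \<open>J\<close> of \<open>m\<close>, the
  expansion of \<open>m \<bullet> \<alpha> k\<close> has only nonpositive terms, as distinct simple
  roots are obtuse, while dominance makes the sum nonnegative. So all terms vanish, \<open>J\<close>
  is orthogonal to its complement, and connectedness gives \<open>J = I\<close>.\<close>

lemma maximal_root_coord_pos:
  assumes "maximal_root m" "i \<in> I"
  shows "m \<bullet> cw i > 0"
proof -
  define J where "J = {i\<in>I. m \<bullet> cw i > 0}"
  have nn: "m \<bullet> cw i \<ge> 0" if "i \<in> I" for i
    using maximal_root_pos[OF assms(1)] that nonneg_combs_nonneg by (auto simp: positive_roots_def)
  have "J \<noteq> {}"
  proof
    assume "J = {}"
    then have "m = 0" using nn by (intro eq_by_coords) (force simp: J_def)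
    then show False using maximal_root_pos[OF assms(1)] pos_root root_nonzero by blast
  qed
  moreover have "\<alpha> j \<bullet> \<alpha> k = 0" if j: "j \<in> J" and k: "k \<in> I - J" for j k
  proof -
    have le: "(m \<bullet> cw l) * (\<alpha> l \<bullet> \<alpha> k) \<le> 0" if "l \<in> I" for l
    proof (cases "l = k")
      case True
      then show ?thesis using nn[of k] k by (simp add: J_def)
    next
      case False
      then show ?thesis using nn[OF that] simple_obtuse[OF that, of k] k by (simp add: mult_nonneg_nonpos)
    qed
    have "(\<Sum>l\<in>I. - ((m \<bullet> cw l) * (\<alpha> l \<bullet> \<alpha> k))) \<le> 0"
      using maximal_root_dominant[OF assms(1), of k] k inner_expansion[of m "\<alpha> k"]
      by (simp add: sum_negf inner_commute)
    moreover have "(\<Sum>l\<in>I. - ((m \<bullet> cw l) * (\<alpha> l \<bullet> \<alpha> k))) \<ge> 0"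
      using le by (intro sum_nonneg) simp
    ultimately have "(\<Sum>l\<in>I. - ((m \<bullet> cw l) * (\<alpha> l \<bullet> \<alpha> k))) = 0" by simp
    then have "\<forall>l\<in>I. - ((m \<bullet> cw l) * (\<alpha> l \<bullet> \<alpha> k)) = 0"
      using le by (subst (asm) sum_nonneg_eq_0_iff) (auto simp: finite_I)
    then show ?thesis using j by (auto simp: J_def)
  qed
  ultimately have "J = I" using simple_connected[of J] J_def by blast
  then show ?thesis using assms(2) by (auto simp: J_def)
qed

text \<open>Positive coordinates of \<open>m\<close> and dominance of \<open>m'\<close> give
  \<open>m \<bullet> m' > 0\<close>. The difference is then a root, so the two are comparable,
  against maximality.\<close>

lemma maximal_root_unique:
  assumes "maximal_root m" "maximal_root m'"
  shows "m = m'"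
proof (rule ccontr)
  assume ne: "m \<noteq> m'"
  have m: "m \<in> \<Phi>" "m' \<in> \<Phi>" using assms by (auto simp: maximal_root_def)
  obtain i where i: "i \<in> I" "\<alpha> i \<bullet> m' \<noteq> 0"
    using eq_by_simple[of m' 0] root_nonzero[OF m(2)] by auto
  have "0 < (\<Sum>i\<in>I. (m \<bullet> cw i) * (\<alpha> i \<bullet> m'))"
  proof (rule sum_pos2[OF finite_I i(1)])
    show "0 < (m \<bullet> cw i) * (\<alpha> i \<bullet> m')"
      using i maximal_root_coord_pos[OF assms(1) i(1)] maximal_root_dominant[OF assms(2) i(1)] by simp
    show "0 \<le> (m \<bullet> cw j) * (\<alpha> j \<bullet> m')" if "j \<in> I" for j
      using maximal_root_coord_pos[OF assms(1) that] maximal_root_dominant[OF assms(2) that] by simp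
  qed
  then have "m \<bullet> m' > 0" by (simp add: inner_expansion[of m m'])
  then have "m - m' \<in> \<Phi>" using root_diff m ne by blast
  then have "m - m' \<in> nonneg_combs \<alpha> \<or> m' - m \<in> nonneg_combs \<alpha>"
    using root_signed[of "m - m'"] by simp
  then show False using assms m ne unfolding maximal_root_def by blast
qed

abbreviation \<theta> :: 'a where "\<theta> \<equiv> highest_root \<Phi> \<alpha>"

lemma highest_root: "\<theta> \<in> \<Phi>" "b \<in> \<Phi> \<Longrightarrow> \<theta> - b \<in> nonneg_combs \<alpha>"
proof -
  obtain r where r: "r \<in> \<Phi>" using irreducible by (auto simp: irreducible_roots_def)
  obtain m where m: "maximal_root m" using maximal_root_above[OF r] by blast
  have above: "m - b \<in> nonneg_combs \<alpha>" if "b \<in> \<Phi>" for b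
    using maximal_root_above[OF that] maximal_root_unique[OF m] by blast
  have "\<theta> = m"
    unfolding highest_root_def
  proof (rule the_equality)
    show "m \<in> \<Phi> \<and> (\<forall>b\<in>\<Phi>. m - b \<in> nonneg_combs \<alpha>)"
      using m above by (simp add: maximal_root_def)
    show "x = m" if "x \<in> \<Phi> \<and> (\<forall>b\<in>\<Phi>. x - b \<in> nonneg_combs \<alpha>)" for x
      using that m by (auto simp: maximal_root_def)
  qed
  then show "\<theta> \<in> \<Phi>" "b \<in> \<Phi> \<Longrightarrow> \<theta> - b \<in> nonneg_combs \<alpha>"
    using m above by (auto simp: maximal_root_def)
qed

lemma highest_coord: "i \<in> I \<Longrightarrow> \<theta> \<bullet> cw i \<ge> 1"
  using nonneg_combs_nonneg[OF highest_root(2)[OF simple_root], of i i]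
  by (simp add: inner_diff_left simple_inner_cw)

lemma highest_pos: "\<theta> \<in> Pos"
proof -
  have "I \<noteq> {}" by (simp add: I_eq)
  then obtain i where "i \<in> I" by blast
  then show ?thesis
    using pos_if_coord_pos[OF highest_root(1), of i] highest_coord[of i] by simp
qed

lemma mark_0: "mark \<Phi> \<alpha> 0 = 1"
  by (simp add: mark_def)

lemma mark_simple:
  assumes "i \<in> I"
  shows "real (mark \<Phi> \<alpha> i) = \<theta> \<bullet> cw i"
proof -
  let ?B = "\<alpha> ` I"
  have "\<theta> = (\<Sum>b\<in>?B. representation ?B \<theta> b *\<^sub>R b)"
    using sum_representation_eq[OF simple_independent, of \<theta> ?B] simple_span finite_I by auto
  then have "\<theta> = (\<Sum>j\<in>I. representation ?B \<theta> (\<alpha> j) *\<^sub>R \<alpha> j)"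
    using simple_inj by (simp add: sum.reindex)
  then have "\<theta> \<bullet> cw i = representation ?B \<theta> (\<alpha> i)"
    using sum_simple_inner_cw[OF assms, of "\<lambda>j. representation ?B \<theta> (\<alpha> j)"] by metis
  moreover have "\<theta> \<bullet> cw i \<in> \<int>" using root_coord_int[OF highest_root(1) assms] .
  moreover have "i \<noteq> 0" using assms by (simp add: I_eq)
  ultimately show ?thesis
    using highest_coord[OF assms] by (auto simp: mark_def I_eq elim!: Ints_cases)
qed

subsection \<open>Symmetries of the fundamental alcove\<close>

abbreviation A0 :: "'a set" where "A0 \<equiv> fundamental_alcove \<Phi> \<alpha>"
abbreviation e :: "nat \<Rightarrow> 'a" where "e \<equiv> extended_simple \<Phi> \<alpha>"
abbreviation J :: "nat set" where "J \<equiv> insert 0 I"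

lemma zero_notin_I: "0 \<notin> I"
  by (simp add: I_eq)

lemma I_nonzero: "i \<in> I \<Longrightarrow> i \<noteq> 0"
  using zero_notin_I by metis

lemma J_eq: "J = {0..DIM('a)}"
  by (auto simp: I_eq)

lemma e_0: "e 0 = - \<theta>"
  by (simp add: extended_simple_def)

lemma e_simple: "i \<in> I \<Longrightarrow> e i = \<alpha> i"
  using zero_notin_I by (auto simp: extended_simple_def)

lemma e_root: "i \<in> J \<Longrightarrow> e i \<in> \<Phi>"
  using highest_root(1) root_uminus simple_root by (auto simp: e_0 e_simple)

lemma e_inj: "inj_on e J"
proof (rule inj_onI)
  fix i j assume ij: "i \<in> J" "j \<in> J" "e i = e j"
  have "e 0 \<notin> Pos" using highest_pos pos_not_neg by (simp add: e_0)
  then have "i = 0 \<longleftrightarrow> j = 0"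
    using ij simple_pos e_simple by (metis insertE)
  then show "i = j"
    using ij simple_inj by (auto simp: e_simple dest: inj_onD)
qed

lemma fundamental_alcove_iff: "x \<in> A0 \<longleftrightarrow> (\<forall>i\<in>I. 0 < \<alpha> i \<bullet> x) \<and> \<theta> \<bullet> x < 1"
  by (simp add: fundamental_alcove_def I_eq)

text \<open>The Coxeter number, equal to the sum of all marks; the summand 1 is the mark at index
  0.\<close>

definition coxeter :: real where
  "coxeter = 1 + ht \<theta>"

text \<open>The point of the fundamental alcove at which the affine functionals defining its walls all
  take the same value \<open>1 / coxeter\<close>.\<close>

definition center :: 'a where
  "center = (1 / coxeter) *\<^sub>R (\<Sum>j\<in>I. cw j)"

lemma coxeter_ge_2: "coxeter \<ge> 2"
  using ht_pos[OF highest_pos] by (simp add: coxeter_def)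

lemma inner_center: "b \<bullet> center = ht b / coxeter"
  by (simp add: center_def ht_def inner_sum_right)

text \<open>These points of \<open>A0\<close> come arbitrarily close to the origin and so test the
  sign of the constant term of an affine root.\<close>

lemma scaled_center_in_alcove:
  assumes "0 < t" "t \<le> 1"
  shows "t *\<^sub>R center \<in> A0"
proof -
  have "0 < t / coxeter" using assms coxeter_ge_2 by simp
  moreover have "ht \<theta> / coxeter < 1" using coxeter_ge_2 by (simp add: coxeter_def)
  moreover have "0 \<le> ht \<theta> / coxeter" using ht_pos[OF highest_pos] coxeter_ge_2 by simp
  ultimately show ?thesis
    using assms mult_left_le_one_le[of "ht \<theta> / coxeter" t]
    by (simp add: fundamental_alcove_iff inner_center ht_simple)
qed

lemma center_in_alcove: "center \<in> A0"
  using scaled_center_in_alcove[of 1] by simp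

text \<open>Multiplied by \<open>coxeter\<close>, the value at \<open>center\<close> is
  \<open>ht b + k * coxeter\<close>. For \<open>k = 0\<close> the root is positive, so its height is
  at least 1, with equality for simple roots. For \<open>k \<ge> 1\<close> the bound
  \<open>ht b \<ge> - ht \<theta>\<close>, where \<open>ht \<theta> = coxeter - 1\<close>, gives the
  same minimum, attained only by \<open>b = - \<theta>\<close> with \<open>k = 1\<close>.\<close>

lemma affine_root_at_center:
  fixes k :: int
  assumes b: "b \<in> \<Phi>" and pos: "\<And>x. x \<in> A0 \<Longrightarrow> b \<bullet> x + k > 0"
  shows "k \<ge> 0" "b \<bullet> center + k \<ge> 1 / coxeter"
    "b \<bullet> center + k = 1 / coxeter \<Longrightarrow> \<exists>j\<in>J. b = e j \<and> k = (if j = 0 then 1 else 0)"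
proof -
  have coxeter: "coxeter > 0" using coxeter_ge_2 by simp
  show k: "k \<ge> 0"
  proof (rule ccontr)
    assume "\<not> ?thesis"
    then have k1: "real_of_int k \<le> - 1" by linarith
    \<comment> \<open>With this \<open>t\<close> the value of \<open>b\<close> at
      \<open>t *\<^sub>R center\<close> is below 1 and cannot compensate for
      \<open>k \<le> - 1\<close>.\<close>
    define t where "t = 1 / (1 + \<bar>b \<bullet> center\<bar>)"
    have t: "0 < t" "t \<le> 1" by (simp_all add: t_def divide_le_eq)
    have "t * (b \<bullet> center) < 1" by (simp add: t_def divide_less_eq) linarith
    then show False using pos[OF scaled_center_in_alcove[OF t]] k1 by simp
  qed
  have "1 \<le> ht b + k * coxeter \<and> (ht b + k * coxeter = 1 \<longrightarrow>
      (\<exists>j\<in>J. b = e j \<and> k = (if j = 0 then 1 else 0)))"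
  proof (cases "k = 0")
    case True
    have "ht b > 0" using pos[OF center_in_alcove] True coxeter by (simp add: inner_center zero_less_divide_iff)
    then have p: "b \<in> Pos" using pos_cases[OF b] ht_pos[of "- b"] by (auto simp: ht_linear)
    have "\<exists>j\<in>J. b = e j \<and> k = (if j = 0 then 1 else 0)" if "ht b = 1"
    proof -
      have "b \<in> nonneg_combs \<alpha>" using p by (simp add: positive_roots_def)
      then obtain j where "j \<in> I" "b = \<alpha> j" using ht_eq_1 \<open>ht b = 1\<close> by blast
      then show ?thesis using True I_nonzero by (intro bexI[of _ j]) (auto simp: e_simple)
    qed
    then show ?thesis using True ht_pos[OF p] by simp
  next
    case False
    then have k1: "real_of_int k \<ge> 1" using k by linarith
    have sum: "\<theta> - - b \<in> nonneg_combs \<alpha>" using highest_root(2)[OF root_uminus[OF b]] .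
    then have nn: "ht \<theta> + ht b \<ge> 0" using ht_nat[OF sum] by (auto simp: ht_linear elim: Nats_cases)
    have *: "ht b + k * coxeter = (ht \<theta> + ht b) + 1 + (real_of_int k - 1) * coxeter"
      by (simp add: coxeter_def algebra_simps)
    have ge: "(real_of_int k - 1) * coxeter \<ge> 0" using k1 coxeter by simp
    have "\<exists>j\<in>J. b = e j \<and> k = (if j = 0 then 1 else 0)" if eq: "ht b + k * coxeter = 1"
    proof -
      have "ht \<theta> + ht b = 0" "(real_of_int k - 1) * coxeter = 0"
        using * nn ge eq by linarith+
      then have "ht (\<theta> - - b) = 0" "(real_of_int k - 1) * coxeter = 0"
        by (simp_all add: ht_linear)
      then have "\<theta> - - b = 0" "k = 1" using ht_eq_0[OF sum] coxeter by auto
      then show ?thesis by (intro bexI[of _ 0]) (auto simp: e_0 eq_neg_iff_add_eq_0 add.commute)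
    qed
    then show ?thesis using * nn ge by simp
  qed
  moreover have "b \<bullet> center + k = (ht b + k * coxeter) / coxeter"
    using coxeter by (simp add: inner_center field_simps)
  ultimately show "b \<bullet> center + k \<ge> 1 / coxeter"
    "b \<bullet> center + k = 1 / coxeter \<Longrightarrow> \<exists>j\<in>J. b = e j \<and> k = (if j = 0 then 1 else 0)"
    using coxeter by (simp_all add: divide_le_cancel)
qed

section \<open>Affine maps that carry the fundamental alcove into itself\<close>

context
  fixes u :: "'a \<Rightarrow> 'a" and \<mu> :: 'a
  assumes u: "u \<in> W" and \<mu>: "\<mu> \<in> Z" and stable: "\<And>x. x \<in> A0 \<Longrightarrow> u x + \<mu> \<in> A0"
begin

text \<open>\<open>d\<close> is the constant term of the wall functional with gradient
  \<open>e i\<close>. Composed with x |-> u x + \<mu>, this functional becomes the affine root with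
  gradient \<open>inv u (e i)\<close> and constant term \<open>e i \<bullet> \<mu> + d\<close>,
  again positive on \<open>A0\<close>, so the bounds at \<open>center\<close> apply to it.\<close>

lemma stabilizer_wall:
  assumes i: "i \<in> J"
  defines "d \<equiv> (if i = 0 then 1 else 0 :: real)"
  shows "1 / coxeter \<le> e i \<bullet> (u center + \<mu>) + d"
    "e i \<bullet> (u center + \<mu>) + d = 1 / coxeter \<Longrightarrow>
      \<exists>j\<in>J. inv u (e i) = e j \<and> e i \<bullet> \<mu> + d = (if j = 0 then 1 else 0)"
    "e i \<bullet> \<mu> + d \<ge> 0"
proof -
  have "e i \<bullet> \<mu> + d \<in> \<int>" using root_coweight_int[OF e_root[OF i] \<mu>] by (simp add: d_def)
  then obtain k :: int where k: "e i \<bullet> \<mu> + d = k" by (elim Ints_cases)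
  have eq: "inv u (e i) \<bullet> x + k = e i \<bullet> (u x + \<mu>) + d" for x
    using weyl_inv_inner[OF u, of "e i" x] k by (simp add: inner_add_right)
  have pos: "inv u (e i) \<bullet> x + k > 0" if "x \<in> A0" for x
    using stable[OF that] i unfolding eq fundamental_alcove_iff
    by (auto simp: d_def e_0 e_simple zero_notin_I)
  note * = affine_root_at_center[OF weyl_root[OF weyl_inv[OF u] e_root[OF i]], of k, OF pos]
  show "1 / coxeter \<le> e i \<bullet> (u center + \<mu>) + d" using *(2) unfolding eq .
  show "e i \<bullet> \<mu> + d \<ge> 0" using *(1) k by simp
  assume "e i \<bullet> (u center + \<mu>) + d = 1 / coxeter"
  then obtain j where "j \<in> J" "inv u (e i) = e j" "k = (if j = 0 then 1 else 0)"
    using *(3) unfolding eq by blast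
  then show "\<exists>j\<in>J. inv u (e i) = e j \<and> e i \<bullet> \<mu> + d = (if j = 0 then 1 else 0)"
    unfolding k by (intro bexI[of _ j]) auto
qed

text \<open>Weighted by the marks, the wall functionals add up to the constant 1. At the image of
  \<open>center\<close> each is at least \<open>1 / coxeter\<close>, its value at
  \<open>center\<close>, so none can be larger there; the values of the simple roots determine the
  point.\<close>

lemma stabilizer_center: "u center + \<mu> = center"
proof (rule eq_by_simple)
  let ?y = "u center + \<mu>"
  have ge: "\<alpha> i \<bullet> (?y - center) \<ge> 0" if "i \<in> I" for i
    using stabilizer_wall(1)[of i] that I_nonzero[OF that]
    by (simp add: e_simple inner_diff_right inner_center ht_simple)
  have nn: "(\<theta> \<bullet> cw i) * (\<alpha> i \<bullet> (?y - center)) \<ge> 0" if "i \<in> I" for i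
    using ge[OF that] highest_coord[OF that] by simp
  have "1 / coxeter \<le> 1 - \<theta> \<bullet> ?y" using stabilizer_wall(1)[of 0] by (simp add: e_0)
  moreover have "\<theta> \<bullet> center = 1 - 1 / coxeter"
    using coxeter_ge_2 by (simp add: inner_center coxeter_def field_simps)
  ultimately have "\<theta> \<bullet> (?y - center) \<le> 0" by (simp add: inner_diff_right)
  moreover have "(\<Sum>i\<in>I. (\<theta> \<bullet> cw i) * (\<alpha> i \<bullet> (?y - center))) \<ge> 0" using nn by (rule sum_nonneg)
  ultimately have "(\<Sum>i\<in>I. (\<theta> \<bullet> cw i) * (\<alpha> i \<bullet> (?y - center))) = 0"
    unfolding inner_expansion[of \<theta> "?y - center"] by linarith
  then have 0: "\<forall>i\<in>I. (\<theta> \<bullet> cw i) * (\<alpha> i \<bullet> (?y - center)) = 0"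
    using nn by (subst (asm) sum_nonneg_eq_0_iff) (auto simp: finite_I)
  fix i assume "i \<in> I"
  then show "\<alpha> i \<bullet> ?y = \<alpha> i \<bullet> center"
    using 0 highest_coord[of i] by (force simp: inner_diff_right)
qed

text \<open>As \<open>center\<close> is fixed, every pulled-back wall functional attains the least
  possible value there, which singles out the walls.\<close>

lemma stabilizer_permutes:
  assumes "i \<in> J"
  shows "\<exists>j\<in>J. inv u (e i) = e j \<and> e i \<bullet> \<mu> + (if i = 0 then 1 else 0) = (if j = 0 then 1 else 0)"
proof (rule stabilizer_wall(2)[OF assms])
  show "e i \<bullet> (u center + \<mu>) + (if i = 0 then 1 else 0) = 1 / coxeter"
    unfolding stabilizer_center using assms zero_notin_I coxeter_ge_2
    by (auto simp: e_0 e_simple inner_center ht_simple ht_linear) (simp add: coxeter_def field_simps)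
qed

lemma stabilizer_free:
  assumes "\<mu> \<in> Q"
  shows "u = id" "\<mu> = 0"
proof -
  have ge: "\<alpha> i \<bullet> \<mu> \<ge> 0" if "i \<in> I" for i
    using stabilizer_wall(3)[of i] that I_nonzero[OF that] by (simp add: e_simple)
  have "b \<bullet> \<mu> \<le> 1" if "b \<in> \<Phi>" for b
  proof -
    have "(\<theta> - b) \<bullet> \<mu> \<ge> 0"
      unfolding inner_expansion[of "\<theta> - b" \<mu>]
      using ge nonneg_combs_nonneg[OF highest_root(2)[OF that]] by (intro sum_nonneg) simp
    moreover have "\<theta> \<bullet> \<mu> \<le> 1" using stabilizer_wall(3)[of 0] by (simp add: e_0)
    ultimately show ?thesis by (simp add: inner_diff_left)
  qed
  then show \<mu>0: "\<mu> = 0" using coroot_lattice_small assms by blast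
  have "inv u (\<alpha> i) \<in> Pos" if i: "i \<in> I" for i
  proof -
    have "i \<noteq> 0" using i by (rule I_nonzero)
    moreover obtain j where "j \<in> J" "inv u (e i) = e j \<and>
        e i \<bullet> \<mu> + (if i = 0 then 1 else 0) = (if j = 0 then 1 else 0)"
      using stabilizer_permutes[of i] i by blast
    \<comment> \<open>With zero translation the constant terms of the two walls agree, so
      \<open>j = 0\<close> cannot occur for \<open>i \<noteq> 0\<close>.\<close>
    ultimately have "j \<in> I" "inv u (\<alpha> i) = \<alpha> j"
      using i \<mu>0 by (auto simp: e_simple split: if_splits)
    then show ?thesis using simple_pos by simp
  qed
  then have "inv u = id" using weyl_preserving_pos[OF weyl_inv[OF u]] by blast
  then show "u = id" using weyl_inv_right[OF u] by (auto simp: fun_eq_iff)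
qed

text \<open>Applying \<open>inv u\<close> to the relation among the extended simple roots permutes
  its coefficients along \<open>\<sigma>\<close>. Independence of the simple roots makes the new
  relation a multiple of the old one; the factor, read off at index 0, is 1 because a permutation
  keeps the sum of the coefficients.\<close>

lemma stabilizer_marks:
  obtains \<sigma> where "bij_betw \<sigma> J J" "\<And>i. i \<in> J \<Longrightarrow> inv u (e i) = e (\<sigma> i)"
    "\<And>i. i \<in> J \<Longrightarrow> mark \<Phi> \<alpha> i = mark \<Phi> \<alpha> (\<sigma> i)"
proof -
  let ?v = "inv u" and ?c = "\<lambda>i. real (mark \<Phi> \<alpha> i)"
  obtain \<sigma> where \<sigma>: "\<And>i. i \<in> J \<Longrightarrow> \<sigma> i \<in> J" "\<And>i. i \<in> J \<Longrightarrow> ?v (e i) = e (\<sigma> i)"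
    using stabilizer_permutes by metis
  have inj: "inj_on \<sigma> J"
  proof (rule inj_onI)
    fix i j assume ij: "i \<in> J" "j \<in> J" "\<sigma> i = \<sigma> j"
    then have "?v (e i) = ?v (e j)" using \<sigma>(2) by simp
    then have "e i = e j" by (metis weyl_inv_right[OF u])
    then show "i = j" using inj_onD[OF e_inj _ ij(1,2)] by blast
  qed
  have fin: "finite J" using finite_I by simp
  have bij: "bij_betw \<sigma> J J"
    unfolding bij_betw_def using inj endo_inj_surj[OF fin image_subsetI inj, OF \<sigma>(1)] by (rule conjI)
  let ?t = "inv_into J \<sigma>"
  have t: "?t j \<in> J" "\<sigma> (?t j) = j" if "j \<in> J" for j
    using that bij bij_betw_inv_into_right[OF bij that] bij_betwE[OF bij_betw_inv_into[OF bij]] by auto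
  have "\<theta> = (\<Sum>i\<in>I. ?c i *\<^sub>R \<alpha> i)"
    by (subst simple_expansion) (simp add: mark_simple cong: sum.cong)
  then have "(\<Sum>i\<in>J. ?c i *\<^sub>R e i) = 0"
    using zero_notin_I finite_I by (simp add: e_0 mark_0 e_simple cong: sum.cong)
  then have "?v (\<Sum>i\<in>J. ?c i *\<^sub>R e i) = 0"
    using linear_0[OF weyl_linear[OF weyl_inv[OF u]]] by simp
  moreover have "?v (\<Sum>i\<in>J. ?c i *\<^sub>R e i) = (\<Sum>i\<in>J. ?c i *\<^sub>R e (\<sigma> i))"
    using \<sigma>(2) linear_cmul[OF weyl_linear[OF weyl_inv[OF u]]]
    unfolding linear_sum[OF weyl_linear[OF weyl_inv[OF u]]] by (intro sum.cong) auto
  moreover have "(\<Sum>i\<in>J. ?c i *\<^sub>R e (\<sigma> i)) = (\<Sum>j\<in>J. ?c (?t j) *\<^sub>R e j)"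
    using sum.reindex_bij_betw[OF bij, of "\<lambda>j. ?c (?t j) *\<^sub>R e j"] inv_into_f_f[OF inj]
    by (metis (no_types, lifting) sum.cong)
  ultimately have rel: "(\<Sum>j\<in>J. ?c (?t j) *\<^sub>R e j) = 0" by metis
  have mult: "?c (?t j) = ?c (?t 0) * ?c j" if j: "j \<in> J" for j
  proof (cases "j = 0")
    case True
    then show ?thesis by (simp add: mark_0)
  next
    case False
    then have jI: "j \<in> I" using j by simp
    have "(\<Sum>j\<in>J. ?c (?t j) *\<^sub>R e j) = ?c (?t 0) *\<^sub>R - \<theta> + (\<Sum>j\<in>I. ?c (?t j) *\<^sub>R \<alpha> j)"
      using zero_notin_I finite_I by (simp add: e_0 e_simple cong: sum.cong)
    then have "(?c (?t 0) *\<^sub>R - \<theta> + (\<Sum>j\<in>I. ?c (?t j) *\<^sub>R \<alpha> j)) \<bullet> cw j = 0"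
      using rel by simp
    then show ?thesis
      using sum_simple_inner_cw[OF jI, of "\<lambda>j. ?c (?t j)"] mark_simple[OF jI]
      by (simp add: inner_diff_left)
  qed
  have "(\<Sum>j\<in>J. ?c j) = (\<Sum>j\<in>J. ?c (?t j))"
    using sum.reindex_bij_betw[OF bij_betw_inv_into[OF bij], of ?c] by simp
  also have "\<dots> = ?c (?t 0) * (\<Sum>j\<in>J. ?c j)"
    unfolding sum_distrib_left by (intro sum.cong mult refl)
  finally have eq: "(\<Sum>j\<in>J. ?c j) = ?c (?t 0) * (\<Sum>j\<in>J. ?c j)" .
  have "(\<Sum>j\<in>J. ?c j) \<noteq> 0"
    using fin by (subst sum_nonneg_eq_0_iff) (auto simp: mark_0)
  then have "?c (?t 0) = 1" using eq by simp
  then have "?c (?t j) = ?c j" if "j \<in> J" for j using mult[OF that] by simp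
  then have "mark \<Phi> \<alpha> i = mark \<Phi> \<alpha> (\<sigma> i)" if "i \<in> J" for i
    using \<sigma>(1)[OF that] inv_into_f_f[OF inj that] by (metis of_nat_eq_iff)
  with bij \<sigma>(2) show ?thesis using that by blast
qed

text \<open>Since \<open>u\<close> sends \<open>e (\<sigma> i)\<close> to \<open>e i\<close> and
  both indices carry the same mark, \<open>\<sigma>\<close> matches the two sums term by
  term.\<close>

lemma asc_stabilizer: "asc \<Phi> \<alpha> (w \<circ> u) = asc \<Phi> \<alpha> w"
proof -
  obtain \<sigma> where bij: "bij_betw \<sigma> J J" and \<sigma>: "\<And>i. i \<in> J \<Longrightarrow> inv u (e i) = e (\<sigma> i)"
    and mark: "\<And>i. i \<in> J \<Longrightarrow> mark \<Phi> \<alpha> i = mark \<Phi> \<alpha> (\<sigma> i)"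
    using stabilizer_marks by blast
  have u\<sigma>: "u (e (\<sigma> i)) = e i" if "i \<in> J" for i
    using \<sigma>[OF that] weyl_inv_right[OF u] by metis
  have bij': "bij_betw \<sigma> {i\<in>J. w (e i) \<in> Pos} {j\<in>J. w (u (e j)) \<in> Pos}"
    unfolding bij_betw_def
  proof
    show "inj_on \<sigma> {i\<in>J. w (e i) \<in> Pos}"
      using bij by (auto simp: bij_betw_def intro: inj_on_subset)
    show "\<sigma> ` {i\<in>J. w (e i) \<in> Pos} = {j\<in>J. w (u (e j)) \<in> Pos}"
    proof (intro set_eqI iffI)
      fix j assume "j \<in> \<sigma> ` {i\<in>J. w (e i) \<in> Pos}"
      then obtain i where i: "i \<in> J" "w (e i) \<in> Pos" "j = \<sigma> i" by blast
      moreover have "\<sigma> i \<in> J" using bspec[OF bij_betwE[OF bij] i(1)] .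
      ultimately show "j \<in> {j\<in>J. w (u (e j)) \<in> Pos}"
        unfolding i(3) mem_Collect_eq u\<sigma>[OF i(1)] by blast
    next
      fix j assume j: "j \<in> {j\<in>J. w (u (e j)) \<in> Pos}"
      then obtain i where i: "i \<in> J" "j = \<sigma> i" using bij_betw_imp_surj_on[OF bij] by blast
      then have "w (e i) \<in> Pos" using j u\<sigma>[OF i(1)] by simp
      then show "j \<in> \<sigma> ` {i\<in>J. w (e i) \<in> Pos}" using i by blast
    qed
  qed
  have "asc \<Phi> \<alpha> (w \<circ> u) = (\<Sum>j\<in>{j\<in>J. w (u (e j)) \<in> Pos}. mark \<Phi> \<alpha> j)"
    by (simp add: asc_def J_eq)
  also have "\<dots> = (\<Sum>i\<in>{i\<in>J. w (e i) \<in> Pos}. mark \<Phi> \<alpha> (\<sigma> i))"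
    by (rule sum.reindex_bij_betw[OF bij', symmetric])
  also have "\<dots> = (\<Sum>i\<in>{i\<in>J. w (e i) \<in> Pos}. mark \<Phi> \<alpha> i)"
    using mark by (intro sum.cong) auto
  also have "\<dots> = asc \<Phi> \<alpha> w" by (simp add: asc_def J_eq)
  finally show ?thesis .
qed

end

text \<open>The first map followed by the inverse of the second carries \<open>A0\<close> into
  itself, with linear part \<open>u\<close> and translation \<open>m\<close>. The three conclusions
  make \<open>asc\<close> a function of the alcove and, for a fixed alcove, the translation a
  function of \<open>w\<close> and \<open>w\<close> a function of the translation modulo Q.\<close>

lemma same_image:
  assumes w: "w \<in> W" "w' \<in> W" and l: "l \<in> Z" "l' \<in> Z"
    and eq: "(\<lambda>x. w x + l) ` A0 = (\<lambda>x. w' x + l') ` A0"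
  shows "asc \<Phi> \<alpha> w = asc \<Phi> \<alpha> w'"
    "w = w' \<Longrightarrow> l = l'"
    "l - l' \<in> Q \<Longrightarrow> w = w'"
proof -
  let ?v = "inv w'"
  define u where "u = ?v \<circ> w"
  define m where "m = ?v (l - l')"
  have v: "?v \<in> W" "linear ?v" using weyl_inv weyl_linear w(2) by auto
  have u: "u \<in> W" using v w weyl_comp by (simp add: u_def)
  have m: "m \<in> Z" using coweight_weyl[OF coweight_diff[OF l] v(1)] by (simp add: m_def)
  have st: "u x + m \<in> A0" if x: "x \<in> A0" for x
  proof -
    obtain y where y: "y \<in> A0" "w x + l = w' y + l'" using eq x by blast
    then have "w x + (l - l') = w' y" by (simp add: algebra_simps)
    then have "u x + m = y"
      unfolding u_def m_def comp_def linear_add[OF v(2), symmetric] using weyl_inv_left[OF w(2)] by simp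
    then show ?thesis using y by simp
  qed
  have w'u: "w' \<circ> u = w" using weyl_inv_right[OF w(2)] by (simp add: u_def fun_eq_iff)
  show "asc \<Phi> \<alpha> w = asc \<Phi> \<alpha> w'" using asc_stabilizer[OF u m st, of w'] w'u by simp
  have w'm: "w' m = l - l'" using weyl_inv_right[OF w(2)] by (simp add: m_def)
  have w'0: "w' 0 = 0" using linear_0 weyl_linear w(2) by blast
  show "l = l'" if "w = w'"
  proof -
    have "u = id" using weyl_inv_left[OF w(2)] unfolding u_def that by (simp add: fun_eq_iff)
    then have "m = 0" using stabilizer_center[OF u m st] by simp
    then show ?thesis using w'm w'0 by simp
  qed
  show "w = w'" if "l - l' \<in> Q"
  proof -
    have "m \<in> Q" using coroot_lattice_weyl[OF that v(1)] by (simp add: m_def)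
    then have "u = id" using stabilizer_free(1)[OF u m st] by blast
    then show ?thesis using w'u by simp
  qed
qed

subsection \<open>Alcoves and the affine Weyl group\<close>

definition regular :: "'a \<Rightarrow> bool" where
  "regular x \<longleftrightarrow> (\<forall>b\<in>\<Phi>. b \<bullet> x \<notin> \<int>)"

text \<open>For regular \<open>x\<close> this is the alcove through \<open>x\<close>, encoded by
  integer parts. Using all roots, not just the positive ones, lets W permute the data without regard
  to signs.\<close>

definition cell :: "'a \<Rightarrow> 'a set" where
  "cell x = {y. regular y \<and> (\<forall>b\<in>\<Phi>. \<lfloor>b \<bullet> y\<rfloor> = \<lfloor>b \<bullet> x\<rfloor>)}"

lemma cell_self: "regular x \<Longrightarrow> x \<in> cell x"
  by (simp add: cell_def)

lemma cell_eq: "y \<in> cell x \<Longrightarrow> cell y = cell x"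
  by (auto simp: cell_def)

lemma regular_iff_pos: "regular x \<longleftrightarrow> (\<forall>b\<in>Pos. b \<bullet> x \<notin> \<int>)"
proof
  assume "\<forall>b\<in>Pos. b \<bullet> x \<notin> \<int>"
  then have "b \<bullet> x \<notin> \<int>" if "b \<in> \<Phi>" for b
    using pos_cases[OF that] by (metis Ints_minus inner_minus_left)
  then show "regular x" by (simp add: regular_def)
qed (simp add: regular_def pos_root)

lemma alcoves_complement: "UNIV - (\<Union>b\<in>Pos. \<Union>k::int. {x. b \<bullet> x = of_int k}) = {x. regular x}"
  by (auto simp: regular_iff_pos elim!: Ints_cases)

lemma convex_cell:
  assumes "regular x"
  shows "convex (cell x)"
proof -
  have "cell x = (\<Inter>b\<in>\<Phi>. {y. b \<bullet> y > \<lfloor>b \<bullet> x\<rfloor>} \<inter> {y. b \<bullet> y < \<lfloor>b \<bullet> x\<rfloor> + 1})" (is "_ = ?R")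
  proof (intro set_eqI iffI)
    fix y assume y: "y \<in> cell x"
    have "b \<bullet> y > \<lfloor>b \<bullet> x\<rfloor> \<and> b \<bullet> y < \<lfloor>b \<bullet> x\<rfloor> + 1" if "b \<in> \<Phi>" for b
    proof -
      have f: "\<lfloor>b \<bullet> y\<rfloor> = \<lfloor>b \<bullet> x\<rfloor>" "b \<bullet> y \<notin> \<int>"
        using y that by (auto simp: cell_def regular_def)
      then have "b \<bullet> y \<noteq> of_int \<lfloor>b \<bullet> y\<rfloor>" by (metis Ints_of_int)
      then show ?thesis unfolding f(1)[symmetric] by linarith
    qed
    then show "y \<in> ?R" by simp
  next
    fix y assume "y \<in> ?R"
    then have f: "b \<bullet> y > of_int \<lfloor>b \<bullet> x\<rfloor>" "b \<bullet> y < of_int \<lfloor>b \<bullet> x\<rfloor> + 1" if "b \<in> \<Phi>" for b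
      using that by auto
    have fl: "\<lfloor>b \<bullet> y\<rfloor> = \<lfloor>b \<bullet> x\<rfloor>" if "b \<in> \<Phi>" for b
      using f[OF that] by linarith
    have "b \<bullet> y \<notin> \<int>" if b: "b \<in> \<Phi>" for b
    proof
      assume "b \<bullet> y \<in> \<int>"
      then obtain k :: int where k: "b \<bullet> y = k" by (elim Ints_cases)
      then have "\<lfloor>b \<bullet> x\<rfloor> = k" using fl[OF b] by simp
      then show False using f(1)[OF b] k by simp
    qed
    then show "y \<in> cell x" using fl by (simp add: cell_def regular_def)
  qed
  then show ?thesis
    by (simp add: convex_INT convex_Int convex_halfspace_gt convex_halfspace_lt)
qed

text \<open>Cells are convex, hence connected. Conversely a connected set of regular points cannot
  change the integer part of a root: by the intermediate value theorem it would meet a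
  hyperplane.\<close>

lemma connected_component_cell:
  assumes "regular x"
  shows "connected_component_set {x. regular x} x = cell x"
proof
  show "cell x \<subseteq> connected_component_set {x. regular x} x"
    using assms by (intro connected_component_maximal cell_self convex_connected convex_cell)
      (auto simp: cell_def)
  show "connected_component_set {x. regular x} x \<subseteq> cell x"
  proof
    fix y assume "y \<in> connected_component_set {x. regular x} x"
    then obtain T where T: "connected T" "T \<subseteq> {x. regular x}" "x \<in> T" "y \<in> T"
      unfolding mem_Collect_eq connected_component_def by blast
    have le: "\<lfloor>b \<bullet> z\<rfloor> \<le> \<lfloor>b \<bullet> z'\<rfloor>" if b: "b \<in> \<Phi>" and z: "z \<in> T" "z' \<in> T" for b z z'
    proof (rule ccontr)
      assume "\<not> ?thesis"
      then have "b \<bullet> z' \<le> of_int \<lfloor>b \<bullet> z\<rfloor>" "of_int \<lfloor>b \<bullet> z\<rfloor> \<le> b \<bullet> z" by linarith+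
      then obtain p where "p \<in> T" "b \<bullet> p = of_int \<lfloor>b \<bullet> z\<rfloor>"
        using connected_ivt_hyperplane[OF T(1) z(2,1)] by blast
      then show False using T(2) b by (force simp: regular_def)
    qed
    have "\<lfloor>b \<bullet> y\<rfloor> = \<lfloor>b \<bullet> x\<rfloor>" if "b \<in> \<Phi>" for b
      using le[OF that T(3,4)] le[OF that T(4,3)] by simp
    then show "y \<in> cell x" using T by (auto simp: cell_def)
  qed
qed

lemma alcoves_eq: "alcoves \<Phi> \<alpha> = cell ` {x. regular x}"
  unfolding alcoves_def alcoves_complement components_def
  by (auto simp: connected_component_cell intro!: image_eqI)

lemma floor_add_Int: "k \<in> \<int> \<Longrightarrow> \<lfloor>x + k\<rfloor> = \<lfloor>x\<rfloor> + \<lfloor>k :: real\<rfloor>"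
  by (elim Ints_cases) simp

text \<open>Pairing with \<open>b\<close> after the map is pairing with the root
  \<open>inv w b\<close> before it, up to the integer \<open>b \<bullet> l\<close>.\<close>

lemma affine_cell_subset:
  assumes "w \<in> W" "l \<in> Z" "y \<in> cell x"
  shows "w y + l \<in> cell (w x + l)"
proof -
  have *: "b \<bullet> (w z + l) = inv w b \<bullet> z + b \<bullet> l" for b z
    using weyl_inv_inner[OF assms(1)] by (simp add: inner_add_right)
  have l: "b \<bullet> l \<in> \<int>" if "b \<in> \<Phi>" for b using root_coweight_int that assms(2) by blast
  have v: "inv w b \<in> \<Phi>" if "b \<in> \<Phi>" for b using weyl_root weyl_inv assms(1) that by blast
  have "b \<bullet> (w y + l) \<notin> \<int>" if "b \<in> \<Phi>" for b
  proof
    assume "b \<bullet> (w y + l) \<in> \<int>"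
    then have "inv w b \<bullet> y \<in> \<int>" using Ints_diff[OF _ l[OF that]] unfolding * by fastforce
    then show False using assms(3) v[OF that] by (auto simp: cell_def regular_def)
  qed
  moreover have "\<lfloor>b \<bullet> (w y + l)\<rfloor> = \<lfloor>b \<bullet> (w x + l)\<rfloor>" if "b \<in> \<Phi>" for b
    unfolding * floor_add_Int[OF l[OF that]] using assms(3) v[OF that] by (simp add: cell_def)
  ultimately show ?thesis by (simp add: cell_def regular_def)
qed

lemma affine_inverse:
  assumes "w \<in> W"
  shows "inv w (w x + l) + inv w (- l) = x" "w (inv w x + inv w (- l)) + l = x"
  using weyl_linear[OF weyl_inv[OF assms]] weyl_inv_left[OF assms] weyl_inv_right[OF assms]
  by (simp_all flip: linear_add)

lemma affine_cell:
  assumes "w \<in> W" "l \<in> Z"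
  shows "(\<lambda>x. w x + l) ` cell x = cell (w x + l)"
proof
  show "(\<lambda>x. w x + l) ` cell x \<subseteq> cell (w x + l)" using affine_cell_subset assms by blast
  show "cell (w x + l) \<subseteq> (\<lambda>x. w x + l) ` cell x"
  proof
    fix y assume "y \<in> cell (w x + l)"
    then have "inv w y + inv w (- l) \<in> cell x"
      using affine_cell_subset[OF weyl_inv[OF assms(1)], of "inv w (- l)" y "w x + l"]
        affine_inverse(1)[OF assms(1)] coweight_weyl[OF coweight_uminus[OF assms(2)] weyl_inv[OF assms(1)]]
      by simp
    then show "y \<in> (\<lambda>x. w x + l) ` cell x"
      using affine_inverse(2)[OF assms(1), of y l] by (metis image_eqI)
  qed
qed

lemma regular_affine: "w \<in> W \<Longrightarrow> l \<in> Z \<Longrightarrow> regular x \<Longrightarrow> regular (w x + l)"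
  using affine_cell_subset[OF _ _ cell_self] by (auto simp: cell_def)

text \<open>A positive root has nonnegative coordinates and lies below \<theta>, so the wall
  conditions bound it on both sides.\<close>

lemma fundamental_alcove_root:
  assumes "x \<in> A0" "b \<in> Pos"
  shows "0 < b \<bullet> x" "b \<bullet> x < 1"
proof -
  have nn: "c \<bullet> x \<ge> 0" if "c \<in> nonneg_combs \<alpha>" for c
    unfolding inner_expansion[of c x]
    using nonneg_combs_nonneg[OF that] assms(1) unfolding fundamental_alcove_iff
    by (intro sum_nonneg mult_nonneg_nonneg) (auto intro: less_imp_le)
  obtain i where i: "i \<in> I" "b \<bullet> cw i \<noteq> 0"
    using eq_by_coords[of b 0] root_nonzero pos_root assms(2) by force
  have bn: "b \<in> nonneg_combs \<alpha>" using assms(2) by (simp add: positive_roots_def)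
  show "0 < b \<bullet> x"
    unfolding inner_expansion[of b x]
  proof (rule sum_pos2[OF finite_I i(1)])
    have "b \<bullet> cw i > 0" using i nonneg_combs_nonneg[OF bn i(1)] by simp
    then show "0 < (b \<bullet> cw i) * (\<alpha> i \<bullet> x)" using assms(1) i(1) by (simp add: fundamental_alcove_iff)
    show "0 \<le> (b \<bullet> cw j) * (\<alpha> j \<bullet> x)" if "j \<in> I" for j
      using assms(1) that nonneg_combs_nonneg[OF bn that]
      by (intro mult_nonneg_nonneg) (auto simp: fundamental_alcove_iff intro: less_imp_le)
  qed
  have "\<theta> - b \<in> nonneg_combs \<alpha>" using highest_root(2) pos_root assms(2) by blast
  from nn[OF this] show "b \<bullet> x < 1" using assms(1) by (simp add: inner_diff_left fundamental_alcove_iff)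
qed

lemma fundamental_alcove_floor:
  assumes "x \<in> A0" "b \<in> \<Phi>"
  shows "b \<bullet> x \<notin> \<int>" "\<lfloor>b \<bullet> x\<rfloor> = (if b \<in> Pos then 0 else - 1)"
proof -
  have p: "c \<bullet> x \<notin> \<int>" if "c \<in> Pos" for c
    using fundamental_alcove_root[OF assms(1) that] by (auto elim!: Ints_cases)
  show "b \<bullet> x \<notin> \<int>"
    using pos_cases[OF assms(2)] p by (metis Ints_minus inner_minus_left)
  show "\<lfloor>b \<bullet> x\<rfloor> = (if b \<in> Pos then 0 else - 1)"
  proof (cases "b \<in> Pos")
    case True
    then show ?thesis using fundamental_alcove_root[OF assms(1) True] by (simp add: floor_eq_iff)
  next
    case False
    then have "- b \<in> Pos" using pos_cases assms(2) by blast
    then show ?thesis using False fundamental_alcove_root[OF assms(1), of "- b"] by (simp add: floor_eq_iff)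
  qed
qed

lemma fundamental_alcove_cell: "A0 = cell center" and center_regular: "regular center"
proof -
  note c = fundamental_alcove_floor[OF center_in_alcove]
  show "regular center" using c by (simp add: regular_def)
  show "A0 = cell center"
  proof (intro set_eqI iffI)
    fix x assume "x \<in> A0"
    then show "x \<in> cell center" using c fundamental_alcove_floor[of x] by (simp add: cell_def regular_def)
  next
    fix x assume x: "x \<in> cell center"
    have "0 < b \<bullet> x \<and> b \<bullet> x < 1" if "b \<in> Pos" for b
    proof -
      have "\<lfloor>b \<bullet> x\<rfloor> = 0" "b \<bullet> x \<notin> \<int>"
        using x c(2)[OF pos_root[OF that]] that pos_root by (auto simp: cell_def regular_def)
      then show ?thesis by (metis Ints_0 floor_eq_iff add_0 of_int_0 order_le_less)
    qed
    then show "x \<in> A0" using simple_pos highest_pos by (simp add: fundamental_alcove_iff)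
  qed
qed

lemma affine_image_alcove:
  assumes "w \<in> W" "l \<in> Z"
  shows "(\<lambda>x. w x + l) ` A0 \<in> alcoves \<Phi> \<alpha>"
  unfolding fundamental_alcove_cell affine_cell[OF assms] alcoves_eq
  using regular_affine[OF assms center_regular] by blast

section \<open>Transitivity of the affine Weyl group on alcoves\<close>

lemma finite_bounded_coweights: "finite {x \<in> Z. norm x \<le> R}"
proof (rule finite_imageD)
  \<comment> \<open>The values of the simple roots on these coweights are integers in a bounded
    range, and they determine the coweight.\<close>
  let ?f = "\<lambda>x. \<lambda>i\<in>I. \<lfloor>\<alpha> i \<bullet> x\<rfloor>"
  let ?P = "\<Pi>\<^sub>E i\<in>I. {- \<lceil>norm (\<alpha> i) * R\<rceil>..\<lceil>norm (\<alpha> i) * R\<rceil>}"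
  have "?f x \<in> ?P" if "x \<in> Z" "norm x \<le> R" for x
  proof -
    have "\<lfloor>\<alpha> i \<bullet> x\<rfloor> \<in> {- \<lceil>norm (\<alpha> i) * R\<rceil>..\<lceil>norm (\<alpha> i) * R\<rceil>}" if i: "i \<in> I" for i
    proof -
      have "\<bar>\<alpha> i \<bullet> x\<bar> \<le> norm (\<alpha> i) * norm x" by (rule Cauchy_Schwarz_ineq2)
      also have "\<dots> \<le> norm (\<alpha> i) * R" using \<open>norm x \<le> R\<close> by (simp add: mult_left_mono)
      finally have ab: "\<bar>\<alpha> i \<bullet> x\<bar> \<le> norm (\<alpha> i) * R" .
      obtain k :: int where "\<alpha> i \<bullet> x = k" using \<open>x \<in> Z\<close> i by (auto simp: coweight_iff elim: Ints_cases)
      then show ?thesis using ab by simp linarith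
    qed
    then show ?thesis by (simp add: PiE_iff)
  qed
  then have "?f ` {x \<in> Z. norm x \<le> R} \<subseteq> ?P" by blast
  moreover have "finite ?P" by (rule finite_PiE) (simp_all add: finite_I)
  ultimately show "finite (?f ` {x \<in> Z. norm x \<le> R})" by (rule finite_subset)
  show "inj_on ?f {x \<in> Z. norm x \<le> R}"
  proof (rule inj_onI)
    fix x y assume xy: "x \<in> {x \<in> Z. norm x \<le> R}" "y \<in> {x \<in> Z. norm x \<le> R}" "?f x = ?f y"
    show "x = y"
    proof (rule eq_by_simple)
      fix i assume i: "i \<in> I"
      then have "\<lfloor>\<alpha> i \<bullet> x\<rfloor> = \<lfloor>\<alpha> i \<bullet> y\<rfloor>" using fun_cong[OF xy(3), of i] by simp
      moreover have "\<alpha> i \<bullet> x \<in> \<int>" "\<alpha> i \<bullet> y \<in> \<int>" using xy i by (auto simp: coweight_iff)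
      ultimately show "\<alpha> i \<bullet> x = \<alpha> i \<bullet> y" by (metis Ints_cases floor_of_int)
    qed
  qed
qed

text \<open>The two factors are the values at \<open>y\<close> and \<open>c\<close> of the
  functional that defines the reflecting hyperplane. If they have opposite signs, the hyperplane
  separates the points and reflecting \<open>y\<close> brings it closer to \<open>c\<close>.\<close>

lemma affine_reflection_norm:
  assumes "b \<noteq> 0"
  shows "(norm (root_reflection b y + k *\<^sub>R coroot b - c))\<^sup>2
    = (norm (y - c))\<^sup>2 + 4 * ((b \<bullet> y - k) * (b \<bullet> c - k)) / (b \<bullet> b)"
proof -
  have bb: "b \<bullet> b \<noteq> 0" using assms by simp
  let ?p = "b \<bullet> y - k" and ?q = "b \<bullet> c - k"
  let ?l = "2 * ?p / (b \<bullet> b)"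
  have eq: "root_reflection b y + k *\<^sub>R coroot b - c = (y - c) - ?l *\<^sub>R b"
    by (simp add: root_reflection_swap coroot_def inner_commute algebra_simps diff_divide_distrib)
  have "(norm (d - l *\<^sub>R b))\<^sup>2 = (norm d)\<^sup>2 - 2 * l * (b \<bullet> d) + l\<^sup>2 * (b \<bullet> b)" for d l
    unfolding power2_norm_eq_inner
    by (simp add: inner_diff_left inner_diff_right inner_commute[of d b] power2_eq_square algebra_simps)
  then have "(norm ((y - c) - ?l *\<^sub>R b))\<^sup>2 = (norm (y - c))\<^sup>2 - 2 * ?l * (b \<bullet> (y - c)) + ?l\<^sup>2 * (b \<bullet> b)" .
  also have "b \<bullet> (y - c) = ?p - ?q" by (simp add: inner_diff_right)
  also have "(norm (y - c))\<^sup>2 - 2 * ?l * (?p - ?q) + ?l\<^sup>2 * (b \<bullet> b)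
      = (norm (y - c))\<^sup>2 + 4 * (?p * ?q) / (b \<bullet> b)"
    using bb by (simp add: power2_eq_square) (simp add: field_simps)
  finally show ?thesis unfolding eq .
qed

text \<open>A point of the orbit of \<open>x\<close> nearest to \<open>center\<close> is not separated from it by any of the
  reflecting hyperplanes.\<close>

lemma affine_weyl_transitive:
  assumes "regular x"
  shows "\<exists>w\<in>W. \<exists>g\<in>Q. w x + g \<in> A0"
proof -
  \<comment> \<open>A translation longer than \<open>R\<close> puts the point farther from
    \<open>center\<close> than \<open>x\<close> is, so the minimum over the finite set
    \<open>S\<close> is the minimum over the whole orbit.\<close>
  define R where "R = norm (x - center) + norm x + norm center"
  define S where "S = W \<times> {g \<in> Q. norm g \<le> R}"
  let ?f = "\<lambda>(w, g). norm (w x + g - center)"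
  have "finite {g \<in> Q. norm g \<le> R}"
    using coroot_lattice_coweight by (intro finite_subset[OF _ finite_bounded_coweights]) auto
  then have fin: "finite S" using finite_weyl by (simp add: S_def)
  have S0: "(id, 0) \<in> S" using weyl_id coroot_lattice_zero by (simp add: S_def R_def)
  obtain m where m: "m \<in> S" "\<And>s. s \<in> S \<Longrightarrow> ?f m \<le> ?f s"
    using fin S0 arg_min_if_finite(1)[of S ?f] arg_min_least[of S _ ?f] by (metis (no_types, lifting) empty_iff)
  obtain w g where wg: "m = (w, g)" by (cases m)
  have w: "w \<in> W" and g: "g \<in> Q" using m(1) by (auto simp: S_def wg)
  let ?y = "w x + g"
  have nearest: "norm (?y - center) \<le> norm (w' x + g' - center)" if w': "w' \<in> W" "g' \<in> Q" for w' g'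
  proof (cases "norm g' \<le> R")
    case True
    then show ?thesis using m(2)[of "(w', g')"] w' by (simp add: S_def wg)
  next
    case False
    have "norm (?y - center) \<le> norm (x - center)" using m(2)[OF S0] by (simp add: wg)
    moreover have "norm g' \<le> norm (w' x + g' - center) + norm (center - w' x)"
      using norm_triangle_ineq[of "w' x + g' - center" "center - w' x"] by simp
    moreover have "norm (center - w' x) \<le> norm center + norm x"
      using norm_triangle_ineq4[of center "w' x"] orthogonal_transformation_norm[OF weyl_orthogonal[OF w'(1)]]
      by simp
    ultimately show ?thesis using False by (simp add: R_def)
  qed
  have side: "(b \<bullet> ?y - of_int k) * (b \<bullet> center - of_int k) \<ge> 0" if b: "b \<in> \<Phi>" for b and k :: int
  proof (rule ccontr)
    assume neg: "\<not> ?thesis"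
    let ?r = "root_reflection b"
    have "?r ?y + of_int k *\<^sub>R coroot b = (?r \<circ> w) x + (?r g + of_int k *\<^sub>R coroot b)"
      by (simp add: linear_add[OF linear_root_reflection])
    moreover have "?r \<circ> w \<in> W" "?r g + of_int k *\<^sub>R coroot b \<in> Q"
      using weyl_step[OF w b] coroot_lattice_add[OF coroot_lattice_weyl[OF g weyl_reflection[OF b]] coroot_multiple[OF b]]
      by auto
    ultimately have "norm (?y - center) \<le> norm (?r ?y + of_int k *\<^sub>R coroot b - center)"
      using nearest by metis
    then have "(norm (?y - center))\<^sup>2 \<le> (norm (?r ?y + of_int k *\<^sub>R coroot b - center))\<^sup>2"
      by (simp add: power_mono)
    then have "0 \<le> 4 * ((b \<bullet> ?y - of_int k) * (b \<bullet> center - of_int k)) / (b \<bullet> b)"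
      unfolding affine_reflection_norm[OF root_nonzero[OF b]] by simp
    moreover have "b \<bullet> b > 0" using root_nonzero[OF b] by simp
    ultimately show False using neg by (simp only: zero_le_divide_iff) linarith
  qed
  have reg: "regular ?y" using regular_affine[OF w coroot_lattice_coweight[OF g] assms] .
  \<comment> \<open>\<open>side\<close> is applied to the walls of \<open>A0\<close>, with
    \<open>k = 0\<close> for the simple roots and \<open>k = 1\<close> for \<theta>; regularity
    makes the inequalities strict.\<close>
  have "0 < \<alpha> i \<bullet> ?y" if i: "i \<in> I" for i
  proof -
    have "0 < \<alpha> i \<bullet> center" using center_in_alcove i by (simp add: fundamental_alcove_iff)
    then have "0 \<le> \<alpha> i \<bullet> ?y" using side[OF simple_root[OF i], of 0] by (simp add: zero_le_mult_iff)
    moreover have "\<alpha> i \<bullet> ?y \<noteq> 0" using reg simple_root[OF i] by (metis Ints_0 regular_def)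
    ultimately show ?thesis by simp
  qed
  moreover have "\<theta> \<bullet> ?y < 1"
  proof -
    have "\<theta> \<bullet> center < 1" using center_in_alcove by (simp add: fundamental_alcove_iff)
    then have "\<theta> \<bullet> ?y \<le> 1" using side[OF highest_root(1), of 1] by (simp add: zero_le_mult_iff)
    moreover have "\<theta> \<bullet> ?y \<noteq> 1" using reg highest_root(1) by (metis Ints_1 regular_def)
    ultimately show ?thesis by simp
  qed
  ultimately have "?y \<in> A0" by (simp add: fundamental_alcove_iff)
  then show ?thesis using w g by blast
qed

text \<open>Move a point of the alcove into \<open>A0\<close>; the inverse map carries
  \<open>A0\<close>, as a cell, back to the cell of that point.\<close>

lemma alcove_image:
  assumes "A \<in> alcoves \<Phi> \<alpha>"
  shows "\<exists>w\<in>W. \<exists>g\<in>Q. A = (\<lambda>x. w x + g) ` A0"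
proof -
  obtain x where x: "regular x" "A = cell x" using assms by (auto simp: alcoves_eq)
  obtain w g where w: "w \<in> W" and g: "g \<in> Q" and y: "w x + g \<in> A0"
    using affine_weyl_transitive[OF x(1)] by blast
  have v: "inv w \<in> W" "inv w (- g) \<in> Q"
    using weyl_inv coroot_lattice_weyl coroot_lattice_uminus w g by auto
  have "A0 = cell (w x + g)" using y cell_eq fundamental_alcove_cell by simp
  then have "(\<lambda>z. inv w z + inv w (- g)) ` A0 = A"
    using affine_cell[OF v(1) coroot_lattice_coweight[OF v(2)], of "w x + g"] affine_inverse(1)[OF w] x(2)
    by simp
  then show ?thesis using v by blast
qed

subsection \<open>Counting alcoves in the parallelepiped\<close>

abbreviation P :: "'a set" where "P \<equiv> fundamental_parallelepiped \<alpha>"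

lemma parallelepiped_iff: "x \<in> P \<longleftrightarrow> (\<forall>i\<in>I. 0 < \<alpha> i \<bullet> x \<and> \<alpha> i \<bullet> x \<le> 1)"
  by (simp add: fundamental_parallelepiped_def I_eq)

text \<open>At a regular point no simple root is 0 or 1, so lying in \<open>P\<close> means that all
  simple roots have integer part 0, a condition constant on cells.\<close>

lemma cell_in_parallelepiped:
  assumes "regular x" "x \<in> P"
  shows "cell x \<subseteq> P"
proof
  fix y assume y: "y \<in> cell x"
  have "0 < \<alpha> i \<bullet> y \<and> \<alpha> i \<bullet> y \<le> 1" if i: "i \<in> I" for i
  proof -
    have "\<alpha> i \<bullet> x \<noteq> 1" "\<alpha> i \<bullet> y \<noteq> 0"
      using assms(1) y simple_root[OF i] Ints_0 Ints_1 unfolding cell_def regular_def by auto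
    moreover have "0 < \<alpha> i \<bullet> x" "\<alpha> i \<bullet> x \<le> 1" using assms(2) i by (auto simp: parallelepiped_iff)
    ultimately have "\<lfloor>\<alpha> i \<bullet> x\<rfloor> = 0" by (simp add: floor_eq_iff)
    then have "\<lfloor>\<alpha> i \<bullet> y\<rfloor> = 0" using y simple_root[OF i] by (simp add: cell_def)
    then show ?thesis using \<open>\<alpha> i \<bullet> y \<noteq> 0\<close> by linarith
  qed
  then show "y \<in> P" by (simp add: parallelepiped_iff)
qed

lemma translate_into_parallelepiped:
  assumes "w \<in> W"
  shows "\<exists>l\<in>Z. (\<lambda>x. w x + l) ` A0 \<subseteq> P"
proof -
  let ?y = "w center"
  \<comment> \<open>Subtracting the integer parts moves the values of all simple roots into [0, 1);
    regularity excludes 0.\<close>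
  obtain l where l: "\<forall>i\<in>I. \<alpha> i \<bullet> l = - of_int \<lfloor>\<alpha> i \<bullet> ?y\<rfloor>"
    using dual_point[of "\<lambda>i. - of_int \<lfloor>\<alpha> i \<bullet> ?y\<rfloor>"] by blast
  then have lZ: "l \<in> Z" by (simp add: coweight_iff)
  have reg: "regular (?y + l)" using regular_affine[OF assms lZ center_regular] .
  have "0 < \<alpha> i \<bullet> (?y + l) \<and> \<alpha> i \<bullet> (?y + l) \<le> 1" if i: "i \<in> I" for i
  proof -
    have "\<alpha> i \<bullet> (?y + l) \<noteq> 0" using reg simple_root[OF i] by (metis Ints_0 regular_def)
    moreover have "\<alpha> i \<bullet> (?y + l) = \<alpha> i \<bullet> ?y - of_int \<lfloor>\<alpha> i \<bullet> ?y\<rfloor>"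
      using l i by (simp add: inner_add_right)
    ultimately show ?thesis by linarith
  qed
  then have "cell (?y + l) \<subseteq> P" using reg by (intro cell_in_parallelepiped) (auto simp: parallelepiped_iff)
  then show ?thesis using lZ affine_cell[OF assms lZ] fundamental_alcove_cell by metis
qed

text \<open>Look at the image of \<open>center\<close>: the interval (0, 1] contains only one
  integer translate of a real number.\<close>

lemma translate_into_parallelepiped_unique:
  assumes "l \<in> Z" "l' \<in> Z" "(\<lambda>x. w x + l) ` A0 \<subseteq> P" "(\<lambda>x. w x + l') ` A0 \<subseteq> P"
  shows "l = l'"
proof (rule eq_by_simple)
  fix i assume i: "i \<in> I"
  have "w center + l \<in> P" "w center + l' \<in> P" using assms(3,4) center_in_alcove by auto
  then have b: "0 < \<alpha> i \<bullet> w center + \<alpha> i \<bullet> l" "\<alpha> i \<bullet> w center + \<alpha> i \<bullet> l \<le> 1"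
    "0 < \<alpha> i \<bullet> w center + \<alpha> i \<bullet> l'" "\<alpha> i \<bullet> w center + \<alpha> i \<bullet> l' \<le> 1"
    using i by (auto simp: parallelepiped_iff inner_add_right)
  have "\<alpha> i \<bullet> l \<in> \<int>" "\<alpha> i \<bullet> l' \<in> \<int>" using assms(1,2) i by (auto simp: coweight_iff)
  then obtain m n :: int where "\<alpha> i \<bullet> l = m" "\<alpha> i \<bullet> l' = n" by (elim Ints_cases)
  moreover from this b have "m = n" by linarith
  ultimately show "\<alpha> i \<bullet> l = \<alpha> i \<bullet> l'" by simp
qed

text \<open>The fibre over \<open>A\<close>, described with translations in Z. The definition of
  \<open>asc_alcove\<close> admits translations in Q, for which \<open>w\<close> is unique.\<close>

definition reps :: "'a set \<Rightarrow> ('a \<Rightarrow> 'a) set" where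
  "reps A = {w \<in> W. \<exists>l\<in>Z. A = (\<lambda>x. w x + l) ` A0}"

text \<open>The element of W with a translation in Q is itself one of the representatives, and
  \<open>asc\<close> agrees on all of them.\<close>

lemma asc_alcove_reps:
  assumes "A \<in> alcoves \<Phi> \<alpha>" "w \<in> reps A"
  shows "asc_alcove \<Phi> \<alpha> A = asc \<Phi> \<alpha> w"
proof -
  obtain l where w: "w \<in> W" and l: "l \<in> Z" "A = (\<lambda>x. w x + l) ` A0" using assms(2) by (auto simp: reps_def)
  have eq: "asc \<Phi> \<alpha> w' = asc \<Phi> \<alpha> w" if "w' \<in> W" "g \<in> Q" "A = (\<lambda>x. w' x + g) ` A0" for w' g
    using same_image(1)[OF that(1) w coroot_lattice_coweight[OF that(2)] l(1)] that(3) l(2) by simp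
  obtain w' g where w': "w' \<in> W" "g \<in> Q" "A = (\<lambda>x. w' x + g) ` A0" using alcove_image[OF assms(1)] by blast
  show ?thesis
    unfolding asc_alcove_def
  proof (rule the_equality)
    show "\<exists>w'\<in>W. \<exists>g\<in>Q. A = (\<lambda>x. w' x + g) ` A0 \<and> asc \<Phi> \<alpha> w = asc \<Phi> \<alpha> w'"
      using w' eq[OF w'] by (intro bexI[of _ w'] bexI[of _ g]) auto
    show "n = asc \<Phi> \<alpha> w" if "\<exists>w'\<in>W. \<exists>g\<in>Q. A = (\<lambda>x. w' x + g) ` A0 \<and> n = asc \<Phi> \<alpha> w'" for n
      using that eq by blast
  qed
qed

text \<open>Sending \<open>w\<close> to the class of the translation \<open>l\<close> with \<open>A = w A0 + l\<close> identifies the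
  representatives of \<open>A\<close> with \<open>Z / Q\<close>.\<close>

lemma card_reps:
  assumes A: "A \<in> alcoves \<Phi> \<alpha>"
  shows "card (reps A) = connection_index \<Phi> \<alpha>"
proof -
  let ?r = "{(x, y). x \<in> Z \<and> y \<in> Z \<and> x - y \<in> Q}"
  have equiv: "equiv Z ?r"
  proof (rule equivI)
    show "?r \<subseteq> Z \<times> Z" by blast
    show "refl_on Z ?r" using coroot_lattice_zero by (auto simp: refl_on_def)
    show "sym ?r"
    proof (rule symI)
      fix x y assume "(x, y) \<in> ?r"
      then show "(y, x) \<in> ?r" using coroot_lattice_uminus[of "x - y"] by simp
    qed
    show "trans ?r"
    proof (rule transI)
      fix x y z assume "(x, y) \<in> ?r" "(y, z) \<in> ?r"
      then show "(x, z) \<in> ?r" using coroot_lattice_add[of "x - y" "y - z"] by simp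
    qed
  qed
  have "\<forall>w\<in>reps A. \<exists>l. l \<in> Z \<and> A = (\<lambda>x. w x + l) ` A0" by (auto simp: reps_def)
  then obtain L where L: "\<And>w. w \<in> reps A \<Longrightarrow> L w \<in> Z \<and> A = (\<lambda>x. w x + L w) ` A0"
    using bchoice[of "reps A" "\<lambda>w l. l \<in> Z \<and> A = (\<lambda>x. w x + l) ` A0"] by blast
  have W: "w \<in> W" if "w \<in> reps A" for w using that by (simp add: reps_def)
  have "bij_betw (\<lambda>w. ?r `` {L w}) (reps A) (Z // ?r)"
    unfolding bij_betw_def
  proof
    show "inj_on (\<lambda>w. ?r `` {L w}) (reps A)"
    proof (rule inj_onI)
      fix w w' assume w: "w \<in> reps A" "w' \<in> reps A" and eq: "?r `` {L w} = ?r `` {L w'}"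
      have "(L w, L w') \<in> ?r"
        using eq_equiv_class[OF eq equiv] L[OF w(2)] by blast
      then have "L w - L w' \<in> Q" by blast
      then show "w = w'"
        using same_image(3)[OF W[OF w(1)] W[OF w(2)]] L[OF w(1)] L[OF w(2)] by metis
    qed
    show "(\<lambda>w. ?r `` {L w}) ` reps A = Z // ?r"
    proof (intro set_eqI iffI)
      fix X assume "X \<in> (\<lambda>w. ?r `` {L w}) ` reps A"
      then obtain w where "w \<in> reps A" "X = ?r `` {L w}" by blast
      then show "X \<in> Z // ?r" using L quotientI[of "L w" Z ?r] by blast
    next
      fix X assume "X \<in> Z // ?r"
      then obtain l where l: "l \<in> Z" "X = ?r `` {l}" by (rule quotientE)
      obtain x where x: "regular x" "A = cell x" using A by (auto simp: alcoves_eq)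
      have "regular (x - l)"
        using regular_affine[OF weyl_id coweight_uminus[OF l(1)] x(1)] by simp
      then have "cell (x - l) \<in> alcoves \<Phi> \<alpha>" by (auto simp: alcoves_eq)
      \<comment> \<open>The class of \<open>l\<close> is reached by writing the alcove A - l as
        w(A0) + g with \<open>g\<close> in Q, so that A = w(A0) + (g + l).\<close>
      then obtain w g where w: "w \<in> W" and g: "g \<in> Q" and c: "cell (x - l) = (\<lambda>x. w x + g) ` A0"
        using alcove_image by blast
      have "A = (\<lambda>y. y + l) ` cell (x - l)"
        using affine_cell[OF weyl_id l(1), of "x - l"] x(2) by simp
      then have Aw: "A = (\<lambda>x. w x + (g + l)) ` A0" unfolding c image_image by (simp add: add.assoc)
      have gl: "g + l \<in> Z" using coroot_lattice_coweight[OF g] l(1) by (rule coweight_add)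
      have wr: "w \<in> reps A" unfolding reps_def using w gl Aw by blast
      \<comment> \<open>\<open>L\<close> is an arbitrary choice, but for given \<open>A\<close> the
        translation is determined by \<open>w\<close>.\<close>
      have "L w = g + l"
        using same_image(2)[OF w w _ gl] L[OF wr] Aw by metis
      then have "(L w, l) \<in> ?r" using gl l(1) g by simp
      then have "?r `` {L w} = X" unfolding l(2) by (rule equiv_class_eq[OF equiv])
      then show "X \<in> (\<lambda>w. ?r `` {L w}) ` reps A" using wr by blast
    qed
  qed
  then show ?thesis unfolding connection_index_def by (rule bij_betw_same_card)
qed

lemma generalized_eulerian_alcoves:
  "generalized_eulerian \<Phi> \<alpha> = (\<Sum>A\<in>{A \<in> alcoves \<Phi> \<alpha>. A \<subseteq> P}. monom 1 (asc_alcove \<Phi> \<alpha> A))"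
proof -
  let ?S = "{A \<in> alcoves \<Phi> \<alpha>. A \<subseteq> P}" and ?f = "connection_index \<Phi> \<alpha>"
  have ne: "reps A \<noteq> {}" if A: "A \<in> alcoves \<Phi> \<alpha>" for A
    using alcove_image[OF A] coroot_lattice_coweight by (auto simp: reps_def)
  have fin: "finite (reps A)" for A
    using finite_weyl by (rule finite_subset[rotated]) (auto simp: reps_def)
  have disjoint: "A = B" if AB: "A \<in> ?S" "B \<in> ?S" "w \<in> reps A" "w \<in> reps B" for A B w
    using AB translate_into_parallelepiped_unique[of _ _ w] by (auto simp: reps_def)
  have cover: "W = (\<Union>A\<in>?S. reps A)"
  proof
    show "(\<Union>A\<in>?S. reps A) \<subseteq> W" by (auto simp: reps_def)
    show "W \<subseteq> (\<Union>A\<in>?S. reps A)"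
    proof
      fix w assume w: "w \<in> W"
      obtain l where l: "l \<in> Z" "(\<lambda>x. w x + l) ` A0 \<subseteq> P" using translate_into_parallelepiped[OF w] by blast
      then have "(\<lambda>x. w x + l) ` A0 \<in> ?S" using affine_image_alcove[OF w l(1)] by simp
      moreover have "w \<in> reps ((\<lambda>x. w x + l) ` A0)" using w l(1) by (auto simp: reps_def)
      ultimately show "w \<in> (\<Union>A\<in>?S. reps A)" by blast
    qed
  qed
  \<comment> \<open>Different alcoves in \<open>P\<close> have disjoint nonempty sets of
    representatives, all inside the finite group W.\<close>
  have finS: "finite ?S"
  proof (rule finite_imageD)
    show "finite (reps ` ?S)"
      by (rule finite_subset[of _ "Pow W"]) (auto simp: reps_def finite_weyl)
    show "inj_on reps ?S"
    proof (rule inj_onI)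
      fix A B assume AB: "A \<in> ?S" "B \<in> ?S" "reps A = reps B"
      obtain w where "w \<in> reps A" using ne AB(1) by blast
      then show "A = B" using disjoint[OF AB(1,2)] AB(3) by blast
    qed
  qed
  have card: "card (reps A) = ?f" if "A \<in> ?S" for A using card_reps that by blast
  \<comment> \<open>As a \<open>card\<close>, \<open>connection_index\<close> would be 0 for an
    infinite quotient. Being the size of a finite nonempty fibre it is nonzero, so dividing by it is
    legitimate.\<close>
  have "?S \<noteq> {}" using cover weyl_id by blast
  then have f: "?f \<noteq> 0" using card ne fin by (metis (no_types, lifting) card_0_eq ex_in_conv mem_Collect_eq)
  have "(\<Sum>w\<in>W. monom 1 (asc \<Phi> \<alpha> w)) = (\<Sum>A\<in>?S. \<Sum>w\<in>reps A. monom (1 :: rat) (asc \<Phi> \<alpha> w))"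
    unfolding cover using finS fin disjoint by (intro sum.UNION_disjoint) blast+
  also have "\<dots> = (\<Sum>A\<in>?S. \<Sum>w\<in>reps A. monom 1 (asc_alcove \<Phi> \<alpha> A))"
    using asc_alcove_reps by (intro sum.cong) auto
  also have "\<dots> = (\<Sum>A\<in>?S. of_nat ?f * monom 1 (asc_alcove \<Phi> \<alpha> A))"
    using card by (intro sum.cong) auto
  also have "\<dots> = smult (of_nat ?f) (\<Sum>A\<in>?S. monom 1 (asc_alcove \<Phi> \<alpha> A))"
    unfolding sum_distrib_left[symmetric] by (simp add: of_nat_poly)
  finally show ?thesis using f by (simp add: generalized_eulerian_def)
qed

end

theorem theorem4p7:
  fixes \<Phi> :: "'a::euclidean_space set" and \<alpha> :: "nat \<Rightarrow> 'a"
  assumes "root_system \<Phi>" and "crystallographic \<Phi>" and "irreducible_roots \<Phi>"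
    and "simple_system \<Phi> \<alpha>"
  shows "generalized_eulerian \<Phi> \<alpha> =
    (\<Sum>A\<in>{A \<in> alcoves \<Phi> \<alpha>. A \<subseteq> fundamental_parallelepiped \<alpha>}. monom 1 (asc_alcove \<Phi> \<alpha> A))"
proof -
  interpret irreducible_root_basis \<Phi> \<alpha> "{1..DIM('a)}"
    using assms by unfold_locales simp_all
  show ?thesis by (rule generalized_eulerian_alcoves)
qed

end
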